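(* An extriangulated category $(\mathcal C,\mathbb E,\mathfrak s)$ satisfies condition (WIC) if and only if the additive category $\mathcal C$ is weakly idempotent complete. Here condition (WIC) means: for any two morphisms $f\colon X\to Y$ and $g\colon Y\to Z$ in $\mathcal C$, (1) if $gf$ is an $\mathfrak s$-inflation, then $f$ is an $\mathfrak s$-inflation; and (2) if $gf$ is an $\mathfrak s$-deflation, then $g$ is an $\mathfrak s$-deflation.
   Context: An additive category is weakly idempotent complete if every retraction has a kernel (equivalently, every section has a cokernel). An extriangulated category is the same thing as an $n$-exangulated category (defined below) with $n=1$. **Complexes.** For an additive category $\mathcal D$, $\mathbf C^{n+2}_{\mathcal D}$ is the category of complexes $X_\bullet\colon X_0\xrightarrow{d^X_0}X_1\to\cdots\to X_n\xrightarrow{d^X_n}X_{n+1}$ over $\mathcal D$ concentrated in degrees $0,\dots,n+1$, with chain maps $f_\bullet=(f_0,\dots,f_{n+1})$. For $A,C\in\mathcal D$, $\mathbf C^{n+2}_{(\mathcal D;A,C)}$ is its subcategory of complexes with $X_0=A$, $X_{n+1}=C$ and chain maps with $f_0=\mathrm{id}_A$, $f_{n+1}=\mathrm{id}_C$; two of its morphisms are homotopic if their difference is null-homotopic as a chain map, and $[X_\bullet]_{\mathcal D}$ is the resulting homotopy equivalence class of $X_\bullet$ in $\mathbf C^{n+2}_{(\mathcal D;A,C)}$. For $X\in\mathcal D$ and $0\le i\le n$, $\mathrm{triv}_i(X)_\bullet$ has $X$ in degrees $i,i+1$ with differential $\mathrm{id}_X$ between them and $0$ elsewhere. **Extensions.**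 Let $\mathbb G\colon\mathcal D^{\mathrm{op}}\times\mathcal D\to\mathsf{Ab}$ be biadditive. For $\delta\in\mathbb G(C,A)$, $a\colon A\to B$, $c\colon D\to C$ write $a_*\delta=\mathbb G(C,a)(\delta)$ and $c^*\delta=\mathbb G(c,A)(\delta)$. For $\delta\in\mathbb G(C,A)$, $\rho\in\mathbb G(D,B)$, a morphism $(a,c)\colon\delta\to\rho$ is a pair $a\colon A\to B$, $c\colon C\to D$ with $a_*\delta=c^*\rho$. An $n$-exangle is a pair $\langle X_\bullet,\delta\rangle$ with $X_\bullet\in\mathbf C^{n+2}_{\mathcal D}$, $\delta\in\mathbb G(X_{n+1},X_0)$, $(d^X_0)_*\delta=0$, $(d^X_n)^*\delta=0$, such that for all $X\in\mathcal D$ the sequences $\mathcal D(X,X_0)\to\cdots\to\mathcal D(X,X_{n+1})\to\mathbb G(X,X_0)$ (last map $f\mapsto f^*\delta$) and $\mathcal D(X_{n+1},X)\to\cdots\to\mathcal D(X_0,X)\to\mathbb G(X_{n+1},X)$ (last map $g\mapsto g_*\delta$) are exact. **Exact realisation.** An exact realisation $\mathfrak r$ of $\mathbb G$ assigns to each $\delta\in\mathbb G(C,A)$ a homotopy equivalence class $\mathfrak r(\delta)$ of an object of $\mathbf C^{n+2}_{(\mathcal D;A,C)}$ such that: (R0) if $[X_\bullet]_{\mathcal D}=\mathfrak r(\delta)$, $[Y_\bullet]_{\mathcal D}=\mathfrak r(\rho)$ and $(a,c)\colon\delta\to\rho$ is a morphism of extensions, there is a chain map $f_\bullet\colon X_\bullet\to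 Y_\bullet$ (a lift of $(a,c)$) with $f_0=a$, $f_{n+1}=c$; (R1) if $\mathfrak r(\delta)=[X_\bullet]_{\mathcal D}$ then $\langle X_\bullet,\delta\rangle$ is an $n$-exangle; (R2) for all $A,C\in\mathcal D$, $\mathfrak r$ sends $0\in\mathbb G(0,A)$ to $[\mathrm{triv}_0(A)_\bullet]_{\mathcal D}$ and $0\in\mathbb G(C,0)$ to $[\mathrm{triv}_n(C)_\bullet]_{\mathcal D}$. If $\mathfrak r(\delta)=[X_\bullet]_{\mathcal D}$, then $\langle X_\bullet,\delta\rangle$ is called $\mathfrak r$-distinguished, $X_\bullet$ an $\mathfrak r$-conflation, $d^X_0$ an $\mathfrak r$-inflation and $d^X_n$ an $\mathfrak r$-deflation. **$n$-exangulated category.** A triple $(\mathcal D,\mathbb G,\mathfrak r)$ with $\mathcal D$ additive, $\mathbb G$ biadditive and $\mathfrak r$ an exact realisation of $\mathbb G$ such that: (EA1) $\mathfrak r$-inflations are closed under composition; (EA1$^{\mathrm{op}}$) $\mathfrak r$-deflations are closed under composition; (EA2) for $c\colon X_{n+1}\to Y_{n+1}$ and $\mathfrak r$-distinguished $\langle X_\bullet,c^*\rho\rangle$, $\langle Y_\bullet,\rho\rangle$ with $A:=X_0=Y_0$, there is a lift $f_\bullet$ of $(\mathrm{id}_A,c)$ such that $\langle M^f_\bullet,(d^X_0)_*\rho\rangle$ is $\mathfrak r$-distinguished, where $M^f_\bullet$ is the complex $X_1\to X_2\oplus Y_1\to\cdots\to X_{n+1}\oplus Y_n\to Y_{n+1}$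 with differentials $\begin{bmatrix}-d^X_1\\ f_1\end{bmatrix}$, then $\begin{bmatrix}-d^X_{i}&0\\ f_{i}&d^Y_{i-1}\end{bmatrix}$ for $i=2,\dots,n$, then $\begin{bmatrix}f_{n+1}&d^Y_n\end{bmatrix}$; (EA2$^{\mathrm{op}}$) for $a\colon X_0\to Y_0$ and $\mathfrak r$-distinguished $\langle X_\bullet,\delta\rangle$, $\langle Y_\bullet,a_*\delta\rangle$ with $C:=X_{n+1}=Y_{n+1}$, there is a lift $f_\bullet$ of $(a,\mathrm{id}_C)$ such that $\langle N^f_\bullet,(d^Y_n)^*\delta\rangle$ is $\mathfrak r$-distinguished, where $N^f_\bullet$ is the complex $X_0\to X_1\oplus Y_0\to\cdots\to X_n\oplus Y_{n-1}\to Y_n$ with differentials $\begin{bmatrix}d^X_0\\ f_0\end{bmatrix}$, then $\begin{bmatrix}d^X_i&0\\ f_i&-d^Y_{i-1}\end{bmatrix}$ for $i=1,\dots,n-1$, then $\begin{bmatrix}f_n&-d^Y_{n-1}\end{bmatrix}$. *)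

theory Defs
  imports "HOL-Algebra.Coset"
begin

section \<open>Additive categories\<close>

text \<open>
  Hom-sets and extension groups are abelian groups, that is, they satisfy the locale
  \<^locale>\<open>comm_group\<close>, whose multiplicative operations get additive names here.
\<close>

abbreviation gadd :: "('a, 'z) monoid_scheme \<Rightarrow> 'a \<Rightarrow> 'a \<Rightarrow> 'a" where
  "gadd H x y \<equiv> x \<otimes>\<^bsub>H\<^esub> y"

abbreviation gzero :: "('a, 'z) monoid_scheme \<Rightarrow> 'a" where
  "gzero H \<equiv> \<one>\<^bsub>H\<^esub>"

abbreviation gneg :: "('a, 'z) monoid_scheme \<Rightarrow> 'a \<Rightarrow> 'a" where
  "gneg H x \<equiv> inv\<^bsub>H\<^esub> x"

record ('o, 'm) precat =
  Obj :: "'o set"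
  Hom :: "'o \<Rightarrow> 'o \<Rightarrow> 'm monoid"
  Ident :: "'o \<Rightarrow> 'm"
  Comp :: "'m \<Rightarrow> 'm \<Rightarrow> 'm"  (infixr "\<cdot>\<index>" 75)

abbreviation Mor :: "('o, 'm) precat \<Rightarrow> 'o \<Rightarrow> 'o \<Rightarrow> 'm set" where
  "Mor D A B \<equiv> carrier (Hom D A B)"

locale category =
  fixes D :: "('o, 'm) precat" (structure)
  assumes Ident_in_Mor: "A \<in> Obj D \<Longrightarrow> Ident D A \<in> Mor D A A"
    and Comp_in_Mor: "\<lbrakk>A \<in> Obj D; B \<in> Obj D; E \<in> Obj D; f \<in> Mor D A B; g \<in> Mor D B E\<rbrakk>
      \<Longrightarrow> g \<cdot> f \<in> Mor D A E"
    and Comp_Ident: "\<lbrakk>A \<in> Obj D; B \<in> Obj D; f \<in> Mor D A B\<rbrakk> \<Longrightarrow> f \<cdot> Ident D A = f"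
    and Ident_Comp: "\<lbrakk>A \<in> Obj D; B \<in> Obj D; f \<in> Mor D A B\<rbrakk> \<Longrightarrow> Ident D B \<cdot> f = f"
    and Comp_assoc: "\<lbrakk>A \<in> Obj D; B \<in> Obj D; E \<in> Obj D; F \<in> Obj D;
        f \<in> Mor D A B; g \<in> Mor D B E; h \<in> Mor D E F\<rbrakk> \<Longrightarrow> (h \<cdot> g) \<cdot> f = h \<cdot> (g \<cdot> f)"
    and Mor_disjoint: "\<lbrakk>A \<in> Obj D; B \<in> Obj D; A' \<in> Obj D; B' \<in> Obj D;
        f \<in> Mor D A B; f \<in> Mor D A' B'\<rbrakk> \<Longrightarrow> A = A' \<and> B = B'"

locale preadditive_category = category +
  assumes Hom_comm_group: "\<lbrakk>A \<in> Obj D; B \<in> Obj D\<rbrakk> \<Longrightarrow> comm_group (Hom D A B)"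
    and Comp_add_left: "\<lbrakk>A \<in> Obj D; B \<in> Obj D; E \<in> Obj D;
        f \<in> Mor D A B; g \<in> Mor D B E; g' \<in> Mor D B E\<rbrakk>
      \<Longrightarrow> gadd (Hom D B E) g g' \<cdot> f = gadd (Hom D A E) (g \<cdot> f) (g' \<cdot> f)"
    and Comp_add_right: "\<lbrakk>A \<in> Obj D; B \<in> Obj D; E \<in> Obj D;
        f \<in> Mor D A B; f' \<in> Mor D A B; g \<in> Mor D B E\<rbrakk>
      \<Longrightarrow> g \<cdot> gadd (Hom D A B) f f' = gadd (Hom D A E) (g \<cdot> f) (g \<cdot> f')"

definition zero_object :: "('o, 'm) precat \<Rightarrow> 'o \<Rightarrow> bool" where
  "zero_object D Z \<longleftrightarrow> Z \<in> Obj D \<and>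
     (\<forall>A \<in> Obj D. (\<exists>!f. f \<in> Mor D A Z) \<and> (\<exists>!f. f \<in> Mor D Z A))"

definition biproduct ::
    "('o, 'm) precat \<Rightarrow> 'o \<Rightarrow> 'o \<Rightarrow> 'o \<Rightarrow> 'm \<Rightarrow> 'm \<Rightarrow> 'm \<Rightarrow> 'm \<Rightarrow> bool" where
  "biproduct D A B P i\<^sub>1 i\<^sub>2 p\<^sub>1 p\<^sub>2 \<longleftrightarrow>
     A \<in> Obj D \<and> B \<in> Obj D \<and> P \<in> Obj D \<and>
     i\<^sub>1 \<in> Mor D A P \<and> i\<^sub>2 \<in> Mor D B P \<and> p\<^sub>1 \<in> Mor D P A \<and> p\<^sub>2 \<in> Mor D P B \<and>
     p\<^sub>1 \<cdot>\<^bsub>D\<^esub> i\<^sub>1 = Ident D A \<and> p\<^sub>2 \<cdot>\<^bsub>D\<^esub> i\<^sub>2 = Ident D B \<and>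
     p\<^sub>1 \<cdot>\<^bsub>D\<^esub> i\<^sub>2 = gzero (Hom D B A) \<and> p\<^sub>2 \<cdot>\<^bsub>D\<^esub> i\<^sub>1 = gzero (Hom D A B) \<and>
     gadd (Hom D P P) (i\<^sub>1 \<cdot>\<^bsub>D\<^esub> p\<^sub>1) (i\<^sub>2 \<cdot>\<^bsub>D\<^esub> p\<^sub>2) = Ident D P"

locale additive_category = preadditive_category +
  assumes zero_object_exists: "\<exists>Z. zero_object D Z"
    and biproduct_exists: "\<lbrakk>A \<in> Obj D; B \<in> Obj D\<rbrakk>
      \<Longrightarrow> \<exists>P i\<^sub>1 i\<^sub>2 p\<^sub>1 p\<^sub>2. biproduct D A B P i\<^sub>1 i\<^sub>2 p\<^sub>1 p\<^sub>2"

definition retraction :: "('o, 'm) precat \<Rightarrow> 'o \<Rightarrow> 'o \<Rightarrow> 'm \<Rightarrow> bool" where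
  "retraction D X Y p \<longleftrightarrow> p \<in> Mor D X Y \<and> (\<exists>s \<in> Mor D Y X. p \<cdot>\<^bsub>D\<^esub> s = Ident D Y)"

definition kernel_of :: "('o, 'm) precat \<Rightarrow> 'o \<Rightarrow> 'o \<Rightarrow> 'm \<Rightarrow> 'o \<Rightarrow> 'm \<Rightarrow> bool" where
  "kernel_of D X Y f K k \<longleftrightarrow> K \<in> Obj D \<and> k \<in> Mor D K X \<and> f \<cdot>\<^bsub>D\<^esub> k = gzero (Hom D K Y) \<and>
     (\<forall>W \<in> Obj D. \<forall>w \<in> Mor D W X. f \<cdot>\<^bsub>D\<^esub> w = gzero (Hom D W Y) \<longrightarrow>
        (\<exists>!u. u \<in> Mor D W K \<and> k \<cdot>\<^bsub>D\<^esub> u = w))"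

definition weakly_idempotent_complete :: "('o, 'm) precat \<Rightarrow> bool" where
  "weakly_idempotent_complete D \<longleftrightarrow>
     (\<forall>X \<in> Obj D. \<forall>Y \<in> Obj D. \<forall>p. retraction D X Y p \<longrightarrow> (\<exists>K k. kernel_of D X Y p K k))"

section \<open>Complexes concentrated in degrees 0 to n + 1\<close>

text \<open>
  Only the objects in degrees at most \<open>n + 1\<close> and the differentials in degrees at most \<open>n\<close> are
  relevant; no definition below depends on the remaining values.
\<close>

record ('o, 'm) cpx =
  ob :: "nat \<Rightarrow> 'o"
  diff :: "nat \<Rightarrow> 'm"

definition is_complex :: "nat \<Rightarrow> ('o, 'm) precat \<Rightarrow> ('o, 'm) cpx \<Rightarrow> bool" where
  "is_complex n D X \<longleftrightarrow>
     (\<forall>i \<le> n + 1. ob X i \<in> Obj D) \<and>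
     (\<forall>i \<le> n. diff X i \<in> Mor D (ob X i) (ob X (i + 1))) \<and>
     (\<forall>i < n. diff X (i + 1) \<cdot>\<^bsub>D\<^esub> diff X i = gzero (Hom D (ob X i) (ob X (i + 2))))"

definition complex_between ::
    "nat \<Rightarrow> ('o, 'm) precat \<Rightarrow> 'o \<Rightarrow> 'o \<Rightarrow> ('o, 'm) cpx \<Rightarrow> bool" where
  "complex_between n D A C X \<longleftrightarrow> is_complex n D X \<and> ob X 0 = A \<and> ob X (n + 1) = C"

definition chain_map ::
    "nat \<Rightarrow> ('o, 'm) precat \<Rightarrow> ('o, 'm) cpx \<Rightarrow> ('o, 'm) cpx \<Rightarrow> (nat \<Rightarrow> 'm) \<Rightarrow> bool" where
  "chain_map n D X Y f \<longleftrightarrow>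
     (\<forall>i \<le> n + 1. f i \<in> Mor D (ob X i) (ob Y i)) \<and>
     (\<forall>i \<le> n. f (i + 1) \<cdot>\<^bsub>D\<^esub> diff X i = diff Y i \<cdot>\<^bsub>D\<^esub> f i)"

definition lift_of ::
    "nat \<Rightarrow> ('o, 'm) precat \<Rightarrow> ('o, 'm) cpx \<Rightarrow> ('o, 'm) cpx \<Rightarrow> 'm \<Rightarrow> 'm \<Rightarrow> (nat \<Rightarrow> 'm) \<Rightarrow> bool" where
  "lift_of n D X Y a c f \<longleftrightarrow> chain_map n D X Y f \<and> f 0 = a \<and> f (n + 1) = c"

definition null_homotopic ::
    "nat \<Rightarrow> ('o, 'm) precat \<Rightarrow> ('o, 'm) cpx \<Rightarrow> ('o, 'm) cpx \<Rightarrow> (nat \<Rightarrow> 'm) \<Rightarrow> bool" where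
  "null_homotopic n D X Y f \<longleftrightarrow>
     (\<exists>h. (\<forall>i \<in> {1..n + 1}. h i \<in> Mor D (ob X i) (ob Y (i - 1))) \<and>
          f 0 = h 1 \<cdot>\<^bsub>D\<^esub> diff X 0 \<and>
          (\<forall>i \<in> {1..n}. f i = gadd (Hom D (ob X i) (ob Y i))
             (diff Y (i - 1) \<cdot>\<^bsub>D\<^esub> h i) (h (i + 1) \<cdot>\<^bsub>D\<^esub> diff X i)) \<and>
          f (n + 1) = diff Y n \<cdot>\<^bsub>D\<^esub> h (n + 1))"

definition homotopic ::
    "nat \<Rightarrow> ('o, 'm) precat \<Rightarrow> ('o, 'm) cpx \<Rightarrow> ('o, 'm) cpx \<Rightarrow> (nat \<Rightarrow> 'm) \<Rightarrow> (nat \<Rightarrow> 'm) \<Rightarrow> bool" where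
  "homotopic n D X Y f g \<longleftrightarrow>
     null_homotopic n D X Y
       (\<lambda>i. gadd (Hom D (ob X i) (ob Y i)) (f i) (gneg (Hom D (ob X i) (ob Y i)) (g i)))"

text \<open>
  Homotopy equivalence in the category of complexes with prescribed ends \<open>A\<close> and \<open>C\<close>, where
  all chain maps are the identity on the ends.
\<close>

definition homotopy_equivalent ::
    "nat \<Rightarrow> ('o, 'm) precat \<Rightarrow> 'o \<Rightarrow> 'o \<Rightarrow> ('o, 'm) cpx \<Rightarrow> ('o, 'm) cpx \<Rightarrow> bool" where
  "homotopy_equivalent n D A C X Y \<longleftrightarrow>
     complex_between n D A C X \<and> complex_between n D A C Y \<and>
     (\<exists>f g. lift_of n D X Y (Ident D A) (Ident D C) f \<and>
            lift_of n D Y X (Ident D A) (Ident D C) g \<and>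
            homotopic n D X X (\<lambda>i. g i \<cdot>\<^bsub>D\<^esub> f i) (\<lambda>i. Ident D (ob X i)) \<and>
            homotopic n D Y Y (\<lambda>i. f i \<cdot>\<^bsub>D\<^esub> g i) (\<lambda>i. Ident D (ob Y i)))"

definition homotopy_class :: "nat \<Rightarrow> ('o, 'm) precat \<Rightarrow> ('o, 'm) cpx \<Rightarrow> ('o, 'm) cpx set" where
  "homotopy_class n D X = {Y. homotopy_equivalent n D (ob X 0) (ob X (n + 1)) X Y}"

definition triv :: "('o, 'm) precat \<Rightarrow> 'o \<Rightarrow> nat \<Rightarrow> 'o \<Rightarrow> ('o, 'm) cpx" where
  "triv D Z i X =
     (let obs = (\<lambda>j. if j = i \<or> j = i + 1 then X else Z)
      in \<lparr>ob = obs,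
          diff = (\<lambda>j. if j = i then Ident D X else gzero (Hom D (obs j) (obs (j + 1))))\<rparr>)"

section \<open>Biadditive functors and extensions\<close>

text \<open>
  \<open>Ext G C A\<close> is the value of the functor at \<open>(C, A)\<close>, and \<open>ExtMap G c a\<close> its value at a pair of
  morphisms \<open>c : D \<rightarrow> C\<close> and \<open>a : A \<rightarrow> B\<close>, a homomorphism from \<open>Ext G C A\<close> to \<open>Ext G D B\<close>.
\<close>

record ('o, 'm, 'e) bifun =
  Ext :: "'o \<Rightarrow> 'o \<Rightarrow> 'e monoid"
  ExtMap :: "'m \<Rightarrow> 'm \<Rightarrow> 'e \<Rightarrow> 'e"

locale biadditive_functor = additive_category D
  for D :: "('o, 'm) precat" (structure) +
  fixes G :: "('o, 'm, 'e) bifun"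
  assumes Ext_comm_group: "\<lbrakk>C \<in> Obj D; A \<in> Obj D\<rbrakk> \<Longrightarrow> comm_group (Ext G C A)"
    and ExtMap_hom: "\<lbrakk>C \<in> Obj D; C' \<in> Obj D; A \<in> Obj D; A' \<in> Obj D;
        c \<in> Mor D C' C; a \<in> Mor D A A'\<rbrakk> \<Longrightarrow> ExtMap G c a \<in> hom (Ext G C A) (Ext G C' A')"
    and ExtMap_Ident: "\<lbrakk>C \<in> Obj D; A \<in> Obj D; \<delta> \<in> carrier (Ext G C A)\<rbrakk>
      \<Longrightarrow> ExtMap G (Ident D C) (Ident D A) \<delta> = \<delta>"
    and ExtMap_Comp: "\<lbrakk>C \<in> Obj D; C' \<in> Obj D; C'' \<in> Obj D; A \<in> Obj D; A' \<in> Obj D; A'' \<in> Obj D;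
        c \<in> Mor D C' C; c' \<in> Mor D C'' C'; a \<in> Mor D A A'; a' \<in> Mor D A' A'';
        \<delta> \<in> carrier (Ext G C A)\<rbrakk>
      \<Longrightarrow> ExtMap G (c \<cdot> c') (a' \<cdot> a) \<delta> = ExtMap G c' a' (ExtMap G c a \<delta>)"
    and ExtMap_add_left: "\<lbrakk>C \<in> Obj D; C' \<in> Obj D; A \<in> Obj D; A' \<in> Obj D;
        c \<in> Mor D C' C; c' \<in> Mor D C' C; a \<in> Mor D A A'; \<delta> \<in> carrier (Ext G C A)\<rbrakk>
      \<Longrightarrow> ExtMap G (gadd (Hom D C' C) c c') a \<delta>
          = gadd (Ext G C' A') (ExtMap G c a \<delta>) (ExtMap G c' a \<delta>)"
    and ExtMap_add_right: "\<lbrakk>C \<in> Obj D; C' \<in> Obj D; A \<in> Obj D; A' \<in> Obj D;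
        c \<in> Mor D C' C; a \<in> Mor D A A'; a' \<in> Mor D A A'; \<delta> \<in> carrier (Ext G C A)\<rbrakk>
      \<Longrightarrow> ExtMap G c (gadd (Hom D A A') a a') \<delta>
          = gadd (Ext G C' A') (ExtMap G c a \<delta>) (ExtMap G c a' \<delta>)"

text \<open>
  For \<open>\<delta>\<close> in \<open>Ext G C A\<close>, the extension \<open>a\<^sub>*\<delta>\<close> is \<open>push D G C a \<delta>\<close> and \<open>c\<^sup>*\<delta>\<close> is \<open>pull D G A c \<delta>\<close>.
\<close>

definition push ::
    "('o, 'm) precat \<Rightarrow> ('o, 'm, 'e) bifun \<Rightarrow> 'o \<Rightarrow> 'm \<Rightarrow> 'e \<Rightarrow> 'e" where
  "push D G C a \<delta> = ExtMap G (Ident D C) a \<delta>"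

definition pull ::
    "('o, 'm) precat \<Rightarrow> ('o, 'm, 'e) bifun \<Rightarrow> 'o \<Rightarrow> 'm \<Rightarrow> 'e \<Rightarrow> 'e" where
  "pull D G A c \<delta> = ExtMap G c (Ident D A) \<delta>"

text \<open>\<open>(a, c)\<close> is a morphism from \<open>\<delta>\<close> in \<open>Ext G C A\<close> to \<open>\<rho>\<close> in \<open>Ext G E B\<close>.\<close>

definition ext_morphism ::
    "('o, 'm) precat \<Rightarrow> ('o, 'm, 'e) bifun \<Rightarrow> 'o \<Rightarrow> 'o \<Rightarrow> 'e \<Rightarrow> 'o \<Rightarrow> 'o \<Rightarrow> 'e \<Rightarrow> 'm \<Rightarrow> 'm \<Rightarrow> bool" where
  "ext_morphism D G C A \<delta> E B \<rho> a c \<longleftrightarrow>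
     a \<in> Mor D A B \<and> c \<in> Mor D C E \<and> push D G C a \<delta> = pull D G B c \<rho>"

definition exangle ::
    "nat \<Rightarrow> ('o, 'm) precat \<Rightarrow> ('o, 'm, 'e) bifun \<Rightarrow> ('o, 'm) cpx \<Rightarrow> 'e \<Rightarrow> bool" where
  "exangle n D G X \<delta> \<longleftrightarrow>
     is_complex n D X \<and> \<delta> \<in> carrier (Ext G (ob X (n + 1)) (ob X 0)) \<and>
     push D G (ob X (n + 1)) (diff X 0) \<delta> = gzero (Ext G (ob X (n + 1)) (ob X 1)) \<and>
     pull D G (ob X 0) (diff X n) \<delta> = gzero (Ext G (ob X n) (ob X 0)) \<and>
     (\<forall>W \<in> Obj D.
        (\<forall>i \<in> {1..n}.
           kernel (Hom D W (ob X i)) (Hom D W (ob X (i + 1))) (\<lambda>f. diff X i \<cdot>\<^bsub>D\<^esub> f)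
           = (\<lambda>f. diff X (i - 1) \<cdot>\<^bsub>D\<^esub> f) ` Mor D W (ob X (i - 1))) \<and>
        kernel (Hom D W (ob X (n + 1))) (Ext G W (ob X 0)) (\<lambda>f. pull D G (ob X 0) f \<delta>)
        = (\<lambda>f. diff X n \<cdot>\<^bsub>D\<^esub> f) ` Mor D W (ob X n)) \<and>
     (\<forall>W \<in> Obj D.
        (\<forall>i \<in> {1..n}.
           kernel (Hom D (ob X i) W) (Hom D (ob X (i - 1)) W) (\<lambda>g. g \<cdot>\<^bsub>D\<^esub> diff X (i - 1))
           = (\<lambda>g. g \<cdot>\<^bsub>D\<^esub> diff X i) ` Mor D (ob X (i + 1)) W) \<and>
        kernel (Hom D (ob X 0) W) (Ext G (ob X (n + 1)) W) (\<lambda>g. push D G (ob X (n + 1)) g \<delta>)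
        = (\<lambda>g. g \<cdot>\<^bsub>D\<^esub> diff X 0) ` Mor D (ob X 1) W)"

section \<open>Exact realisations\<close>

type_synonym ('o, 'm, 'e) realisation = "'o \<Rightarrow> 'o \<Rightarrow> 'e \<Rightarrow> ('o, 'm) cpx set"

text \<open>The value of a realisation \<open>r\<close> at \<open>\<delta>\<close> in \<open>Ext G C A\<close> is \<open>r C A \<delta>\<close>.\<close>

locale exact_realisation = biadditive_functor D G
  for n :: nat and D :: "('o, 'm) precat" (structure) and G :: "('o, 'm, 'e) bifun" +
  fixes r :: "('o, 'm, 'e) realisation"
  assumes realisation_class: "\<lbrakk>C \<in> Obj D; A \<in> Obj D; \<delta> \<in> carrier (Ext G C A)\<rbrakk>
      \<Longrightarrow> \<exists>X. complex_between n D A C X \<and> r C A \<delta> = homotopy_class n D X"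
    and R0: "\<lbrakk>C \<in> Obj D; A \<in> Obj D; E \<in> Obj D; B \<in> Obj D;
        \<delta> \<in> carrier (Ext G C A); \<rho> \<in> carrier (Ext G E B);
        complex_between n D A C X; r C A \<delta> = homotopy_class n D X;
        complex_between n D B E Y; r E B \<rho> = homotopy_class n D Y;
        ext_morphism D G C A \<delta> E B \<rho> a c\<rbrakk>
      \<Longrightarrow> \<exists>f. lift_of n D X Y a c f"
    and R1: "\<lbrakk>C \<in> Obj D; A \<in> Obj D; \<delta> \<in> carrier (Ext G C A);
        complex_between n D A C X; r C A \<delta> = homotopy_class n D X\<rbrakk> \<Longrightarrow> exangle n D G X \<delta>"
    and R2_left: "\<lbrakk>A \<in> Obj D; zero_object D Z\<rbrakk>
      \<Longrightarrow> r Z A (gzero (Ext G Z A)) = homotopy_class n D (triv D Z 0 A)"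
    and R2_right: "\<lbrakk>C \<in> Obj D; zero_object D Z\<rbrakk>
      \<Longrightarrow> r C Z (gzero (Ext G C Z)) = homotopy_class n D (triv D Z n C)"

definition distinguished ::
    "nat \<Rightarrow> ('o, 'm) precat \<Rightarrow> ('o, 'm, 'e) bifun \<Rightarrow> ('o, 'm, 'e) realisation
      \<Rightarrow> ('o, 'm) cpx \<Rightarrow> 'e \<Rightarrow> bool" where
  "distinguished n D G r X \<delta> \<longleftrightarrow>
     is_complex n D X \<and> \<delta> \<in> carrier (Ext G (ob X (n + 1)) (ob X 0)) \<and>
     r (ob X (n + 1)) (ob X 0) \<delta> = homotopy_class n D X"

definition inflation ::
    "nat \<Rightarrow> ('o, 'm) precat \<Rightarrow> ('o, 'm, 'e) bifun \<Rightarrow> ('o, 'm, 'e) realisation \<Rightarrow> 'm \<Rightarrow> bool" where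
  "inflation n D G r f \<longleftrightarrow> (\<exists>X \<delta>. distinguished n D G r X \<delta> \<and> diff X 0 = f)"

definition deflation ::
    "nat \<Rightarrow> ('o, 'm) precat \<Rightarrow> ('o, 'm, 'e) bifun \<Rightarrow> ('o, 'm, 'e) realisation \<Rightarrow> 'm \<Rightarrow> bool" where
  "deflation n D G r f \<longleftrightarrow> (\<exists>X \<delta>. distinguished n D G r X \<delta> \<and> diff X n = f)"

section \<open>Mapping cones and n-exangulated categories\<close>

text \<open>
  The direct sums in a mapping cone are only determined up to isomorphism, so the two
  definitions below are relations: \<open>M\<close> is built from some choice of biproduct in each degree.
  A block matrix is spelled out through the injections \<open>i\<^sub>1\<close>, \<open>i\<^sub>2\<close> and the projections
  \<open>p\<^sub>1\<close>, \<open>p\<^sub>2\<close> of these biproducts; for instance, the matrix with rows \<open>(a, 0)\<close> and \<open>(b, c)\<close> is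
  \<open>i\<^sub>1 a p\<^sub>1 + (i\<^sub>2 b p\<^sub>1 + i\<^sub>2 c p\<^sub>2)\<close>.
\<close>

definition col_matrix ::
    "('o, 'm) precat \<Rightarrow> 'o \<Rightarrow> 'o \<Rightarrow> 'm \<Rightarrow> 'm \<Rightarrow> 'm \<Rightarrow> 'm \<Rightarrow> 'm" where
  "col_matrix D S T i\<^sub>1 i\<^sub>2 a b = gadd (Hom D S T) (i\<^sub>1 \<cdot>\<^bsub>D\<^esub> a) (i\<^sub>2 \<cdot>\<^bsub>D\<^esub> b)"

definition row_matrix ::
    "('o, 'm) precat \<Rightarrow> 'o \<Rightarrow> 'o \<Rightarrow> 'm \<Rightarrow> 'm \<Rightarrow> 'm \<Rightarrow> 'm \<Rightarrow> 'm" where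
  "row_matrix D S T p\<^sub>1 p\<^sub>2 a b = gadd (Hom D S T) (a \<cdot>\<^bsub>D\<^esub> p\<^sub>1) (b \<cdot>\<^bsub>D\<^esub> p\<^sub>2)"

definition lower_matrix ::
    "('o, 'm) precat \<Rightarrow> 'o \<Rightarrow> 'o \<Rightarrow> 'm \<Rightarrow> 'm \<Rightarrow> 'm \<Rightarrow> 'm \<Rightarrow> 'm \<Rightarrow> 'm \<Rightarrow> 'm \<Rightarrow> 'm" where
  "lower_matrix D S T i\<^sub>1 i\<^sub>2 p\<^sub>1 p\<^sub>2 a b c =
     gadd (Hom D S T) (i\<^sub>1 \<cdot>\<^bsub>D\<^esub> a \<cdot>\<^bsub>D\<^esub> p\<^sub>1)
       (gadd (Hom D S T) (i\<^sub>2 \<cdot>\<^bsub>D\<^esub> b \<cdot>\<^bsub>D\<^esub> p\<^sub>1) (i\<^sub>2 \<cdot>\<^bsub>D\<^esub> c \<cdot>\<^bsub>D\<^esub> p\<^sub>2))"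

definition mapping_cone ::
    "nat \<Rightarrow> ('o, 'm) precat \<Rightarrow> ('o, 'm) cpx \<Rightarrow> ('o, 'm) cpx \<Rightarrow> (nat \<Rightarrow> 'm) \<Rightarrow> ('o, 'm) cpx \<Rightarrow> bool" where
  "mapping_cone n D X Y f M \<longleftrightarrow>
     ob M 0 = ob X 1 \<and> ob M (n + 1) = ob Y (n + 1) \<and>
     (\<exists>i\<^sub>1 i\<^sub>2 p\<^sub>1 p\<^sub>2.
        (\<forall>j \<in> {1..n}. biproduct D (ob X (j + 1)) (ob Y j) (ob M j) (i\<^sub>1 j) (i\<^sub>2 j) (p\<^sub>1 j) (p\<^sub>2 j)) \<and>
        diff M 0 = col_matrix D (ob M 0) (ob M 1) (i\<^sub>1 1) (i\<^sub>2 1)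
          (gneg (Hom D (ob X 1) (ob X 2)) (diff X 1)) (f 1) \<and>
        (\<forall>j \<in> {2..n}. diff M (j - 1) =
           lower_matrix D (ob M (j - 1)) (ob M j) (i\<^sub>1 j) (i\<^sub>2 j) (p\<^sub>1 (j - 1)) (p\<^sub>2 (j - 1))
             (gneg (Hom D (ob X j) (ob X (j + 1))) (diff X j)) (f j) (diff Y (j - 1))) \<and>
        diff M n = row_matrix D (ob M n) (ob M (n + 1)) (p\<^sub>1 n) (p\<^sub>2 n) (f (n + 1)) (diff Y n))"

definition mapping_cocone ::
    "nat \<Rightarrow> ('o, 'm) precat \<Rightarrow> ('o, 'm) cpx \<Rightarrow> ('o, 'm) cpx \<Rightarrow> (nat \<Rightarrow> 'm) \<Rightarrow> ('o, 'm) cpx \<Rightarrow> bool" where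
  "mapping_cocone n D X Y f N \<longleftrightarrow>
     ob N 0 = ob X 0 \<and> ob N (n + 1) = ob Y n \<and>
     (\<exists>i\<^sub>1 i\<^sub>2 p\<^sub>1 p\<^sub>2.
        (\<forall>j \<in> {1..n}. biproduct D (ob X j) (ob Y (j - 1)) (ob N j) (i\<^sub>1 j) (i\<^sub>2 j) (p\<^sub>1 j) (p\<^sub>2 j)) \<and>
        diff N 0 = col_matrix D (ob N 0) (ob N 1) (i\<^sub>1 1) (i\<^sub>2 1) (diff X 0) (f 0) \<and>
        (\<forall>j \<in> {1..<n}. diff N j =
           lower_matrix D (ob N j) (ob N (j + 1)) (i\<^sub>1 (j + 1)) (i\<^sub>2 (j + 1)) (p\<^sub>1 j) (p\<^sub>2 j)
             (diff X j) (f j) (gneg (Hom D (ob Y (j - 1)) (ob Y j)) (diff Y (j - 1)))) \<and>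
        diff N n = row_matrix D (ob N n) (ob N (n + 1)) (p\<^sub>1 n) (p\<^sub>2 n)
          (f n) (gneg (Hom D (ob Y (n - 1)) (ob Y n)) (diff Y (n - 1))))"

locale n_exangulated_category = exact_realisation n D G r
  for n :: nat and D :: "('o, 'm) precat" (structure) and G :: "('o, 'm, 'e) bifun"
    and r :: "('o, 'm, 'e) realisation" +
  assumes n_pos: "1 \<le> n"
    and EA1: "\<lbrakk>A \<in> Obj D; B \<in> Obj D; E \<in> Obj D; f \<in> Mor D A B; g \<in> Mor D B E;
        inflation n D G r f; inflation n D G r g\<rbrakk> \<Longrightarrow> inflation n D G r (g \<cdot> f)"
    and EA1_op: "\<lbrakk>A \<in> Obj D; B \<in> Obj D; E \<in> Obj D; f \<in> Mor D A B; g \<in> Mor D B E;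
        deflation n D G r f; deflation n D G r g\<rbrakk> \<Longrightarrow> deflation n D G r (g \<cdot> f)"
    and EA2: "\<lbrakk>c \<in> Mor D (ob X (n + 1)) (ob Y (n + 1)); ob X 0 = A; ob Y 0 = A;
        distinguished n D G r X (pull D G A c \<rho>); distinguished n D G r Y \<rho>\<rbrakk>
      \<Longrightarrow> \<exists>f M. lift_of n D X Y (Ident D A) c f \<and> mapping_cone n D X Y f M \<and>
            distinguished n D G r M (push D G (ob Y (n + 1)) (diff X 0) \<rho>)"
    and EA2_op: "\<lbrakk>a \<in> Mor D (ob X 0) (ob Y 0); ob X (n + 1) = C; ob Y (n + 1) = C;
        distinguished n D G r X \<delta>; distinguished n D G r Y (push D G C a \<delta>)\<rbrakk>
      \<Longrightarrow> \<exists>f N. lift_of n D X Y a (Ident D C) f \<and> mapping_cocone n D X Y f N \<and>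
            distinguished n D G r N (pull D G (ob X 0) (diff Y n) \<delta>)"

definition extriangulated_category ::
    "('o, 'm) precat \<Rightarrow> ('o, 'm, 'e) bifun \<Rightarrow> ('o, 'm, 'e) realisation \<Rightarrow> bool" where
  "extriangulated_category D G r \<longleftrightarrow> n_exangulated_category 1 D G r"

definition condition_WIC ::
    "('o, 'm) precat \<Rightarrow> ('o, 'm, 'e) bifun \<Rightarrow> ('o, 'm, 'e) realisation \<Rightarrow> bool" where
  "condition_WIC D G r \<longleftrightarrow>
     (\<forall>X \<in> Obj D. \<forall>Y \<in> Obj D. \<forall>Z \<in> Obj D. \<forall>f \<in> Mor D X Y. \<forall>g \<in> Mor D Y Z.
        (inflation 1 D G r (g \<cdot>\<^bsub>D\<^esub> f) \<longrightarrow> inflation 1 D G r f) \<and>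
        (deflation 1 D G r (g \<cdot>\<^bsub>D\<^esub> f) \<longrightarrow> deflation 1 D G r g))"

end

theory Submission
  imports Defs
begin

text \<open>
  Let the category be extriangulated. Why (WIC) forces kernels of retractions: an identity is
  always a deflation, so if \<open>p s = 1\<close> then (WIC) makes \<open>p\<close> a deflation,
  say in a conflation \<open>K \<rightarrow> X \<rightarrow> Y\<close> that realises
  \<open>\<delta>\<close>. Then \<open>\<delta> = s\<^sup>*p\<^sup>*\<delta> = 0\<close>, so the
  inflation \<open>k : K \<rightarrow> X\<close> is a split monomorphism, and the weak kernel
  \<open>k\<close> of \<open>p\<close> is a kernel (\<open>short_exangle_split_kernel\<close>).

  Conversely, suppose retractions have kernels. A kernel of a retraction is a complement of its
  section, so every section is the inclusion of a summand
  (\<open>weakly_idempotent_complete_complement\<close>). Let \<open>g f\<close> be an inflation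
  with \<open>f : X \<rightarrow> Y\<close> and \<open>g : Y \<rightarrow> Z\<close>. Pushing its
  conflation out along \<open>f\<close> shows that
  \<open>(g f, f) : X \<rightarrow> Z \<oplus> Y\<close> is an inflation. This is
  \<open>e f\<close> for the section \<open>e = (g, 1)\<close>, so it remains to cancel a section
  \<open>e\<close> from the left of an inflation (\<open>conf_section_cancel\<close>). Complete
  \<open>e f\<close> to a conflation \<open>X \<rightarrow> P \<rightarrow> W\<close> that realises
  \<open>\<delta>\<close>, and let \<open>Z\<close> be a complement of \<open>Y\<close> in
  \<open>P\<close>. The projection \<open>P \<rightarrow> Z\<close> kills \<open>e f\<close>, hence
  factors over \<open>W\<close>, and this exhibits \<open>Z\<close> as a summand of
  \<open>W\<close> too, say with complement \<open>k : K \<rightarrow> W\<close>. Splitting off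
  \<open>Z = Z\<close> leaves an exangle \<open>X \<rightarrow> Y \<rightarrow> K\<close> with
  extension \<open>k\<^sup>*\<delta>\<close> and first map \<open>f\<close>
  (\<open>short_exangle_retract\<close>). A realisation
  \<open>X \<rightarrow> Y' \<rightarrow> K\<close> of \<open>k\<^sup>*\<delta>\<close> maps to
  \<open>X \<rightarrow> P \<rightarrow> W\<close> by a lift of \<open>(1, k)\<close>, and
  composing with \<open>P \<rightarrow> Y\<close> gives a comparison
  \<open>Y' \<rightarrow> Y\<close> of exangles with the same extension; by the four lemma, applied
  on both sides, it is invertible (\<open>short_exangle_comparison_iso\<close>). As realisations
  are closed under isomorphism, \<open>f\<close> is an inflation.

  The statement on deflations is the dual one. To obtain it from the same proof, the facts used
  about conflations are collected in the locale \<open>conflation_structure\<close>, which is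
  stable under passing to the opposite category.
\<close>

section \<open>Source and target of a morphism\<close>

text \<open>
  Morphisms between different pairs of objects are distinct, so each morphism has a unique source
  and target. With these as functions the typing conditions of a composite become equations that
  are solved by rewriting, without guessing intermediate objects.
\<close>

context category
begin

definition arrow :: "'m \<Rightarrow> bool" where
  "arrow f \<longleftrightarrow> (\<exists>A \<in> Obj D. \<exists>B \<in> Obj D. f \<in> Mor D A B)"

definition src :: "'m \<Rightarrow> 'o" where
  "src f = (THE A. A \<in> Obj D \<and> (\<exists>B \<in> Obj D. f \<in> Mor D A B))"

definition tgt :: "'m \<Rightarrow> 'o" where
  "tgt f = (THE B. B \<in> Obj D \<and> (\<exists>A \<in> Obj D. f \<in> Mor D A B))"

lemma arrowI: "\<lbrakk>A \<in> Obj D; B \<in> Obj D; f \<in> Mor D A B\<rbrakk> \<Longrightarrow> arrow f \<and> src f = A \<and> tgt f = B"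
  unfolding arrow_def src_def tgt_def using Mor_disjoint by (blast intro: the_equality)

lemma arrow_in_Mor:
  assumes "arrow f" shows "src f \<in> Obj D" "tgt f \<in> Obj D" "f \<in> Mor D (src f) (tgt f)"
  using assms arrowI unfolding arrow_def by blast+

lemma Mor_iff: "\<lbrakk>A \<in> Obj D; B \<in> Obj D\<rbrakk> \<Longrightarrow> f \<in> Mor D A B \<longleftrightarrow> arrow f \<and> src f = A \<and> tgt f = B"
  using arrowI arrow_in_Mor by blast

lemma Ident_arrow:
  assumes "A \<in> Obj D" shows "arrow (Ident D A)" "src (Ident D A) = A" "tgt (Ident D A) = A"
  using assms Ident_in_Mor arrowI by blast+

lemma Comp_arrow:
  assumes "arrow f" "arrow g" "src g = tgt f"
  shows "arrow (g \<cdot> f)" "src (g \<cdot> f) = src f" "tgt (g \<cdot> f) = tgt g"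
proof -
  have "g \<cdot> f \<in> Mor D (src f) (tgt g)"
    using assms arrow_in_Mor[of f] arrow_in_Mor[of g] Comp_in_Mor by metis
  then show "arrow (g \<cdot> f)" "src (g \<cdot> f) = src f" "tgt (g \<cdot> f) = tgt g"
    using assms arrow_in_Mor arrowI by blast+
qed

lemma Comp_arrow_Ident:
  assumes "arrow f" shows "src f = A \<Longrightarrow> f \<cdot> Ident D A = f" "tgt f = A \<Longrightarrow> Ident D A \<cdot> f = f"
  using assms arrow_in_Mor Comp_Ident Ident_Comp by blast+

lemma Comp_arrow_assoc:
  assumes "arrow f" "arrow g" "arrow h" "src g = tgt f" "src h = tgt g"
  shows "(h \<cdot> g) \<cdot> f = h \<cdot> (g \<cdot> f)"
  using assms arrow_in_Mor[of f] arrow_in_Mor[of g] arrow_in_Mor[of h] Comp_assoc by metis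

lemmas arrow_simps = arrow_in_Mor(1,2) Mor_iff Ident_arrow Comp_arrow Comp_arrow_Ident Comp_arrow_assoc

end

section \<open>Addition of morphisms\<close>

context preadditive_category
begin

lemma Hom_group: "\<lbrakk>A \<in> Obj D; B \<in> Obj D\<rbrakk> \<Longrightarrow> group (Hom D A B)"
  using Hom_comm_group comm_group.axioms(2) by blast

lemma Hom_monoid: "\<lbrakk>A \<in> Obj D; B \<in> Obj D\<rbrakk> \<Longrightarrow> monoid (Hom D A B)"
  using Hom_group group.is_monoid by blast

lemma gzero_arrow:
  assumes "A \<in> Obj D" "B \<in> Obj D"
  shows "arrow (gzero (Hom D A B))" "src (gzero (Hom D A B)) = A" "tgt (gzero (Hom D A B)) = B"
  using assms arrowI monoid.one_closed[OF Hom_monoid] by blast+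

lemma gadd_arrow:
  assumes "A \<in> Obj D" "B \<in> Obj D" "f \<in> Mor D A B" "g \<in> Mor D A B"
  shows "arrow (gadd (Hom D A B) f g)" "src (gadd (Hom D A B) f g) = A"
    "tgt (gadd (Hom D A B) f g) = B"
  using assms arrowI monoid.m_closed[OF Hom_monoid] by blast+

lemma gneg_arrow:
  assumes "A \<in> Obj D" "B \<in> Obj D" "f \<in> Mor D A B"
  shows "arrow (gneg (Hom D A B) f)" "src (gneg (Hom D A B) f) = A"
    "tgt (gneg (Hom D A B) f) = B"
  using assms arrowI group.inv_closed[OF Hom_group] by blast+

lemma gadd_Comp:
  assumes "B \<in> Obj D" "E \<in> Obj D" "arrow f" "tgt f = B" "g \<in> Mor D B E" "g' \<in> Mor D B E"
  shows "gadd (Hom D B E) g g' \<cdot> f = gadd (Hom D (src f) E) (g \<cdot> f) (g' \<cdot> f)"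
  using assms arrow_in_Mor[of f] Comp_add_left by blast

lemma Comp_gadd:
  assumes "A \<in> Obj D" "B \<in> Obj D" "arrow g" "src g = B" "f \<in> Mor D A B" "f' \<in> Mor D A B"
  shows "g \<cdot> gadd (Hom D A B) f f' = gadd (Hom D A (tgt g)) (g \<cdot> f) (g \<cdot> f')"
  using assms arrow_in_Mor[of g] Comp_add_right by blast

lemma gzero_Comp:
  assumes "B \<in> Obj D" "E \<in> Obj D" "arrow f" "tgt f = B"
  shows "gzero (Hom D B E) \<cdot> f = gzero (Hom D (src f) E)"
proof -
  interpret H: group "Hom D B E" using assms Hom_group by blast
  interpret H': group "Hom D (src f) E" using assms Hom_group arrow_in_Mor by blast
  let ?z = "gzero (Hom D B E)"
  have "gadd (Hom D (src f) E) (?z \<cdot> f) (?z \<cdot> f) = ?z \<cdot> f"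
    using gadd_Comp[of B E f ?z ?z] assms by simp
  moreover have "?z \<cdot> f \<in> Mor D (src f) E" using assms by (simp add: arrow_simps gzero_arrow)
  ultimately show ?thesis using H'.l_cancel_one by blast
qed

lemma Comp_gzero:
  assumes "A \<in> Obj D" "B \<in> Obj D" "arrow g" "src g = B"
  shows "g \<cdot> gzero (Hom D A B) = gzero (Hom D A (tgt g))"
proof -
  interpret H: group "Hom D A B" using assms Hom_group by blast
  interpret H': group "Hom D A (tgt g)" using assms Hom_group arrow_in_Mor by blast
  let ?z = "gzero (Hom D A B)"
  have "gadd (Hom D A (tgt g)) (g \<cdot> ?z) (g \<cdot> ?z) = g \<cdot> ?z"
    using Comp_gadd[of A B g ?z ?z] assms by simp
  moreover have "g \<cdot> ?z \<in> Mor D A (tgt g)" using assms by (simp add: arrow_simps gzero_arrow)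
  ultimately show ?thesis using H'.l_cancel_one by blast
qed

lemma gneg_Comp:
  assumes "B \<in> Obj D" "E \<in> Obj D" "arrow f" "tgt f = B" "g \<in> Mor D B E"
  shows "gneg (Hom D B E) g \<cdot> f = gneg (Hom D (src f) E) (g \<cdot> f)"
proof -
  interpret H: group "Hom D B E" using assms Hom_group by blast
  interpret H': group "Hom D (src f) E" using assms Hom_group arrow_in_Mor by blast
  have "gadd (Hom D (src f) E) (gneg (Hom D B E) g \<cdot> f) (g \<cdot> f) = gzero (Hom D (src f) E)"
    using gadd_Comp[of B E f "gneg (Hom D B E) g" g] gzero_Comp assms by simp
  then show ?thesis using H'.inv_equality assms by (simp add: arrow_simps gneg_arrow)
qed

lemma Comp_gneg:
  assumes "A \<in> Obj D" "B \<in> Obj D" "arrow g" "src g = B" "f \<in> Mor D A B"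
  shows "g \<cdot> gneg (Hom D A B) f = gneg (Hom D A (tgt g)) (g \<cdot> f)"
proof -
  interpret H: group "Hom D A B" using assms Hom_group by blast
  interpret H': group "Hom D A (tgt g)" using assms Hom_group arrow_in_Mor by blast
  have "gadd (Hom D A (tgt g)) (g \<cdot> gneg (Hom D A B) f) (g \<cdot> f) = gzero (Hom D A (tgt g))"
    using Comp_gadd[of A B g "gneg (Hom D A B) f" f] Comp_gzero assms by simp
  then show ?thesis using H'.inv_equality assms by (simp add: arrow_simps gneg_arrow)
qed

lemma gadd_group_laws:
  assumes "A \<in> Obj D" "B \<in> Obj D" "f \<in> Mor D A B"
  shows "gadd (Hom D A B) f (gzero (Hom D A B)) = f"
    "gadd (Hom D A B) (gzero (Hom D A B)) f = f"
    "gadd (Hom D A B) f (gneg (Hom D A B) f) = gzero (Hom D A B)"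
    "gadd (Hom D A B) (gneg (Hom D A B) f) f = gzero (Hom D A B)"
    "g \<in> Mor D A B \<Longrightarrow> gadd (Hom D A B) (gneg (Hom D A B) f) (gadd (Hom D A B) f g) = g"
    "g \<in> Mor D A B \<Longrightarrow> gadd (Hom D A B) f (gadd (Hom D A B) (gneg (Hom D A B) f) g) = g"
    "g \<in> Mor D A B \<Longrightarrow> gadd (Hom D A B) f g = gadd (Hom D A B) g f"
    "\<lbrakk>g \<in> Mor D A B; h \<in> Mor D A B\<rbrakk> \<Longrightarrow>
      gadd (Hom D A B) (gadd (Hom D A B) f g) h = gadd (Hom D A B) f (gadd (Hom D A B) g h)"
    "\<lbrakk>g \<in> Mor D A B; h \<in> Mor D A B\<rbrakk> \<Longrightarrow>
      gadd (Hom D A B) g (gadd (Hom D A B) f h) = gadd (Hom D A B) f (gadd (Hom D A B) g h)"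
    "gneg (Hom D A B) (gneg (Hom D A B) f) = f"
    "g \<in> Mor D A B \<Longrightarrow> gneg (Hom D A B) (gadd (Hom D A B) f g)
      = gadd (Hom D A B) (gneg (Hom D A B) f) (gneg (Hom D A B) g)"
proof -
  interpret H: comm_group "Hom D A B" using assms Hom_comm_group by blast
  show "gadd (Hom D A B) f (gzero (Hom D A B)) = f"
    "gadd (Hom D A B) (gzero (Hom D A B)) f = f"
    "gadd (Hom D A B) f (gneg (Hom D A B) f) = gzero (Hom D A B)"
    "gadd (Hom D A B) (gneg (Hom D A B) f) f = gzero (Hom D A B)"
    "gneg (Hom D A B) (gneg (Hom D A B) f) = f"
    using assms by simp_all
  show "g \<in> Mor D A B \<Longrightarrow> gneg (Hom D A B) (gadd (Hom D A B) f g)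
      = gadd (Hom D A B) (gneg (Hom D A B) f) (gneg (Hom D A B) g)"
    using assms by (simp add: H.inv_mult)
  show "g \<in> Mor D A B \<Longrightarrow> gadd (Hom D A B) (gneg (Hom D A B) f) (gadd (Hom D A B) f g) = g"
    "g \<in> Mor D A B \<Longrightarrow> gadd (Hom D A B) f (gadd (Hom D A B) (gneg (Hom D A B) f) g) = g"
    "\<lbrakk>g \<in> Mor D A B; h \<in> Mor D A B\<rbrakk> \<Longrightarrow>
      gadd (Hom D A B) (gadd (Hom D A B) f g) h = gadd (Hom D A B) f (gadd (Hom D A B) g h)"
    using assms by (simp_all add: H.m_assoc[symmetric]) 
  show "g \<in> Mor D A B \<Longrightarrow> gadd (Hom D A B) f g = gadd (Hom D A B) g f"
    "\<lbrakk>g \<in> Mor D A B; h \<in> Mor D A B\<rbrakk> \<Longrightarrow>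
      gadd (Hom D A B) g (gadd (Hom D A B) f h) = gadd (Hom D A B) f (gadd (Hom D A B) g h)"
    using assms H.m_comm H.m_lcomm by blast+
qed

lemma gneg_gzero:
  assumes "A \<in> Obj D" "B \<in> Obj D"
  shows "gneg (Hom D A B) (gzero (Hom D A B)) = gzero (Hom D A B)"
  using assms monoid.inv_one[OF Hom_monoid] by blast

lemma eq_if_diff_zero:
  assumes "A \<in> Obj D" "B \<in> Obj D" "f \<in> Mor D A B" "g \<in> Mor D A B"
    "gadd (Hom D A B) f (gneg (Hom D A B) g) = h" 
  shows "f = gadd (Hom D A B) h g"
  using assms group.inv_solve_right[OF Hom_group, of A B h f g] gadd_arrow gneg_arrow
  by (metis Mor_iff)

text \<open>
  Rewriting with associativity and commutativity cancels a term and its negative only when ordering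
  makes them neighbours, which is not guaranteed in this sum.
\<close>

lemma gadd_telescope:
  assumes "A \<in> Obj D" "B \<in> Obj D" "f \<in> Mor D A B" "g \<in> Mor D A B" "h \<in> Mor D A B"
  shows "gadd (Hom D A B) (gadd (Hom D A B) f (gneg (Hom D A B) g))
      (gadd (Hom D A B) g (gneg (Hom D A B) h)) = gadd (Hom D A B) f (gneg (Hom D A B) h)"
proof -
  interpret H: comm_group "Hom D A B" using assms Hom_comm_group by blast
  show ?thesis using assms by (simp add: H.m_assoc) (simp add: H.m_assoc[symmetric])
qed

text \<open>
  As rewrite rules these turn an equation between sums of composites into one between sums of
  right-nested composites in a fixed order.
\<close>

lemmas additive_simps = arrow_simps gzero_arrow gadd_arrow gneg_arrow gadd_Comp Comp_gadd
  gzero_Comp Comp_gzero gneg_Comp Comp_gneg gadd_group_laws gneg_gzero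

section \<open>Complements of split monomorphisms\<close>

lemma biproduct_arrow:
  assumes "biproduct D A B P i j p q"
  shows "A \<in> Obj D" "B \<in> Obj D" "P \<in> Obj D"
   "i \<in> Mor D A P" "j \<in> Mor D B P" "p \<in> Mor D P A" "q \<in> Mor D P B"
   "p \<cdot> i = Ident D A" "q \<cdot> j = Ident D B" "p \<cdot> j = gzero (Hom D B A)" "q \<cdot> i = gzero (Hom D A B)"
   "gadd (Hom D P P) (i \<cdot> p) (j \<cdot> q) = Ident D P"
  using assms unfolding biproduct_def by auto

text \<open>
  If \<open>q u = 1\<close>, then \<open>1 - u q\<close> is killed by \<open>q\<close>, so it
  factors through the kernel \<open>k\<close> of \<open>q\<close> as \<open>k l\<close>; since
  \<open>k\<close> is monic, \<open>l\<close> is the missing projection.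
\<close>

lemma weakly_idempotent_complete_complement:
  assumes wic: "weakly_idempotent_complete D"
    and ob: "Z \<in> Obj D" "W \<in> Obj D" and u: "u \<in> Mor D Z W" and q: "q \<in> Mor D W Z"
    and qu: "q \<cdot> u = Ident D Z"
  obtains K k l where "biproduct D Z K W u k q l"
proof -
  have "retraction D W Z q" unfolding retraction_def using q u qu by blast
  then obtain K k where "kernel_of D W Z q K k"
    using wic ob unfolding weakly_idempotent_complete_def by blast
  then have K: "K \<in> Obj D" and k: "k \<in> Mor D K W" and qk: "q \<cdot> k = gzero (Hom D K Z)"
    and fac: "\<And>A w. A \<in> Obj D \<Longrightarrow> w \<in> Mor D A W \<Longrightarrow> q \<cdot> w = gzero (Hom D A Z) \<Longrightarrow>
      \<exists>!x. x \<in> Mor D A K \<and> k \<cdot> x = w"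
    unfolding kernel_of_def by auto
  note [simp] = ob K
  have [simp]: "arrow u" "src u = Z" "tgt u = W" "arrow q" "src q = W" "tgt q = Z"
    "arrow k" "src k = K" "tgt k = W" using u q k by (simp_all add: arrow_simps)
  let ?n = "gadd (Hom D W W) (Ident D W) (gneg (Hom D W W) (u \<cdot> q))"
  have quq: "q \<cdot> u \<cdot> q = q" using qu Comp_arrow_assoc[of q u q] by (simp add: additive_simps)
  have "\<exists>!x. x \<in> Mor D W K \<and> k \<cdot> x = ?n"
    using quq by (intro fac) (simp_all add: additive_simps)
  then obtain l where l: "l \<in> Mor D W K" and kl: "k \<cdot> l = ?n" by blast
  have [simp]: "arrow l" "src l = W" "tgt l = K" using l by (simp_all add: arrow_simps)
  have mono: "x = y" if "x \<in> Mor D A K" "y \<in> Mor D A K" "k \<cdot> x = k \<cdot> y" "A \<in> Obj D" for A x y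
  proof -
    have "q \<cdot> k \<cdot> x = gzero (Hom D A Z)"
      using qk that Comp_arrow_assoc[of x k q] by (simp add: additive_simps)
    then have "\<exists>!z. z \<in> Mor D A K \<and> k \<cdot> z = k \<cdot> x"
      using that by (intro fac) (simp_all add: additive_simps)
    then show ?thesis using that by metis
  qed
  have klk: "(k \<cdot> l) \<cdot> k = k" unfolding kl using qk by (simp add: additive_simps)
  have "k \<cdot> l \<cdot> k = (k \<cdot> l) \<cdot> k" by (simp add: arrow_simps)
  also note klk
  finally have "k \<cdot> l \<cdot> k = k" .
  then have lk: "l \<cdot> k = Ident D K" by - (rule mono[of _ K], simp_all add: additive_simps)
  have klu: "(k \<cdot> l) \<cdot> u = gzero (Hom D Z W)"
    unfolding kl using qu by (simp add: additive_simps)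
  then have "k \<cdot> l \<cdot> u = gzero (Hom D Z W)"
    using Comp_arrow_assoc[of u l k] by simp
  then have lu: "l \<cdot> u = gzero (Hom D Z K)" by - (rule mono[of _ Z], simp_all add: additive_simps)
  have "gadd (Hom D W W) (u \<cdot> q) (k \<cdot> l) = Ident D W"
    by (simp add: kl additive_simps)
  then have "biproduct D Z K W u k q l"
    unfolding biproduct_def using u k q l qu lk qk lu by simp
  then show ?thesis by (rule that)
qed

section \<open>Homotopy equivalence of complexes\<close>

lemma is_complex_arrow:
  assumes "is_complex n D X"
  shows "i \<le> Suc n \<Longrightarrow> ob X i \<in> Obj D"
    "i \<le> n \<Longrightarrow> arrow (diff X i)" "i \<le> n \<Longrightarrow> src (diff X i) = ob X i"
    "i \<le> n \<Longrightarrow> tgt (diff X i) = ob X (Suc i)"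
  using assms unfolding is_complex_def by (auto simp: Mor_iff)

lemma chain_map_arrow:
  assumes "is_complex n D X" "is_complex n D Y" "chain_map n D X Y f"
  shows "i \<le> Suc n \<Longrightarrow> arrow (f i)" "i \<le> Suc n \<Longrightarrow> src (f i) = ob X i"
    "i \<le> Suc n \<Longrightarrow> tgt (f i) = ob Y i" "i \<le> n \<Longrightarrow> f (Suc i) \<cdot> diff X i = diff Y i \<cdot> f i"
  using assms unfolding chain_map_def by (auto simp: Mor_iff is_complex_arrow)

lemma chain_map_comp:
  assumes "is_complex n D X" "is_complex n D Y" "is_complex n D V"
    and f: "chain_map n D X Y f" and g: "chain_map n D Y V g"
  shows "chain_map n D X V (\<lambda>i. g i \<cdot> f i)"
proof -
  note a = is_complex_arrow[OF assms(1)] is_complex_arrow[OF assms(2)] is_complex_arrow[OF assms(3)]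
    chain_map_arrow[OF assms(1,2) f] chain_map_arrow[OF assms(2,3) g]
  have "(g (Suc i) \<cdot> f (Suc i)) \<cdot> diff X i = diff V i \<cdot> (g i \<cdot> f i)" if "i \<le> n" for i
  proof -
    have "(g (Suc i) \<cdot> f (Suc i)) \<cdot> diff X i = (g (Suc i) \<cdot> diff Y i) \<cdot> f i"
      using that a(16)[of i] by (simp add: arrow_simps a(1-15) a(17-19))
    also have "\<dots> = diff V i \<cdot> (g i \<cdot> f i)"
      using that a(20)[of i] by (simp add: arrow_simps a)
    finally show ?thesis .
  qed
  then show ?thesis unfolding chain_map_def by (simp add: arrow_simps a)
qed

lemma null_homotopic_cong:
  assumes "\<And>i. i \<le> n + 1 \<Longrightarrow> f i = g i"
  shows "null_homotopic n D X Y f \<longleftrightarrow> null_homotopic n D X Y g"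
  unfolding null_homotopic_def using assms by simp

lemma null_homotopic_add:
  assumes X: "is_complex n D X" and Y: "is_complex n D Y"
    and f: "null_homotopic n D X Y f" and g: "null_homotopic n D X Y g"
  shows "null_homotopic n D X Y (\<lambda>i. gadd (Hom D (ob X i) (ob Y i)) (f i) (g i))"
proof -
  obtain h k where
    h: "\<forall>i \<in> {1..n + 1}. h i \<in> Mor D (ob X i) (ob Y (i - 1))" "f 0 = h 1 \<cdot> diff X 0"
      "\<forall>i \<in> {1..n}. f i = gadd (Hom D (ob X i) (ob Y i)) (diff Y (i - 1) \<cdot> h i) (h (i + 1) \<cdot> diff X i)"
      "f (n + 1) = diff Y n \<cdot> h (n + 1)" and
    k: "\<forall>i \<in> {1..n + 1}. k i \<in> Mor D (ob X i) (ob Y (i - 1))" "g 0 = k 1 \<cdot> diff X 0"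
      "\<forall>i \<in> {1..n}. g i = gadd (Hom D (ob X i) (ob Y i)) (diff Y (i - 1) \<cdot> k i) (k (i + 1) \<cdot> diff X i)"
      "g (n + 1) = diff Y n \<cdot> k (n + 1)"
    using f g unfolding null_homotopic_def by blast
  note a = is_complex_arrow[OF X] is_complex_arrow[OF Y]
  have hk: "arrow (h (Suc j))" "src (h (Suc j)) = ob X (Suc j)" "tgt (h (Suc j)) = ob Y j"
    "arrow (k (Suc j))" "src (k (Suc j)) = ob X (Suc j)" "tgt (k (Suc j)) = ob Y j"
    if "j \<le> n" for j
    using that h(1)[rule_format, of "Suc j"] k(1)[rule_format, of "Suc j"]
    by (auto simp: Mor_iff a)
  show ?thesis
    unfolding null_homotopic_def
  proof (intro exI conjI ballI)
    let ?l = "\<lambda>i. gadd (Hom D (ob X i) (ob Y (i - 1))) (h i) (k i)"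
    show "?l i \<in> Mor D (ob X i) (ob Y (i - 1))" if "i \<in> {1..n + 1}" for i
      using that by (cases i) (simp_all add: additive_simps a hk)
    show "gadd (Hom D (ob X 0) (ob Y 0)) (f 0) (g 0) = ?l 1 \<cdot> diff X 0"
      by (simp add: h(2) k(2) additive_simps a hk)
    show "gadd (Hom D (ob X (n + 1)) (ob Y (n + 1))) (f (n + 1)) (g (n + 1))
        = diff Y n \<cdot> ?l (n + 1)"
      unfolding h(4) k(4) by (simp add: additive_simps a hk)
    fix i assume i: "i \<in> {1..n}"
    then obtain j where j: "i = Suc j" by (cases i) auto
    have fi: "f i = gadd (Hom D (ob X i) (ob Y i)) (diff Y j \<cdot> h i) (h (Suc i) \<cdot> diff X i)"
      "g i = gadd (Hom D (ob X i) (ob Y i)) (diff Y j \<cdot> k i) (k (Suc i) \<cdot> diff X i)"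
      using h(3) k(3) i j by auto
    show "gadd (Hom D (ob X i) (ob Y i)) (f i) (g i) =
      gadd (Hom D (ob X i) (ob Y i)) (diff Y (i - 1) \<cdot> ?l i) (?l (i + 1) \<cdot> diff X i)"
      unfolding fi using i unfolding j by (simp add: additive_simps a hk)
  qed
qed

text \<open>
  If \<open>h\<close> is a null-homotopy of \<open>f\<close>, then
  \<open>b (i - 1) \<cdot> h i \<cdot> a i\<close> is one of \<open>b f a\<close>.
\<close>

lemma null_homotopic_comp:
  assumes W: "is_complex n D W" and X: "is_complex n D X" and Y: "is_complex n D Y"
    and V: "is_complex n D V"
    and a: "chain_map n D W X a" and f: "null_homotopic n D X Y f" and b: "chain_map n D Y V b"
  shows "null_homotopic n D W V (\<lambda>i. b i \<cdot> f i \<cdot> a i)"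
proof -
  obtain h where
    h: "\<forall>i \<in> {1..n + 1}. h i \<in> Mor D (ob X i) (ob Y (i - 1))" "f 0 = h 1 \<cdot> diff X 0"
      "\<forall>i \<in> {1..n}. f i = gadd (Hom D (ob X i) (ob Y i)) (diff Y (i - 1) \<cdot> h i) (h (i + 1) \<cdot> diff X i)"
      "f (n + 1) = diff Y n \<cdot> h (n + 1)"
    using f unfolding null_homotopic_def by blast
  note c = is_complex_arrow[OF W] is_complex_arrow[OF X] is_complex_arrow[OF Y]
    is_complex_arrow[OF V] chain_map_arrow(1-3)[OF W X a] chain_map_arrow(1-3)[OF Y V b]
  have hh: "arrow (h (Suc j))" "src (h (Suc j)) = ob X (Suc j)" "tgt (h (Suc j)) = ob Y j"
    if "j \<le> n" for j
    using that h(1)[rule_format, of "Suc j"] by (auto simp: Mor_iff c)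
  have ad: "x \<cdot> diff X i \<cdot> a i = (x \<cdot> a (Suc i)) \<cdot> diff W i"
    if "i \<le> n" "arrow x" "src x = ob X (Suc i)" for i x
    using that by (simp add: arrow_simps c chain_map_arrow(4)[OF W X a])
  have bd: "b (Suc i) \<cdot> diff Y i \<cdot> x = diff V i \<cdot> b i \<cdot> x"
    if "i \<le> n" "arrow x" "tgt x = ob Y i" for i x
    using that chain_map_arrow(4)[OF Y V b, of i]
      Comp_arrow_assoc[of x "diff Y i" "b (Suc i)"] by (simp add: arrow_simps c)
  show ?thesis
    unfolding null_homotopic_def
  proof (intro exI conjI ballI)
    let ?l = "\<lambda>i. b (i - 1) \<cdot> h i \<cdot> a i"
    show "?l i \<in> Mor D (ob W i) (ob V (i - 1))" if "i \<in> {1..n + 1}" for i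
      using that by (cases i) (simp_all add: additive_simps c hh)
    show "b 0 \<cdot> f 0 \<cdot> a 0 = ?l 1 \<cdot> diff W 0"
      using ad[of 0 "h 1"] by (simp add: h(2) arrow_simps c hh)
    show "b (n + 1) \<cdot> f (n + 1) \<cdot> a (n + 1) = diff V n \<cdot> ?l (n + 1)"
      unfolding h(4) using bd[of n "h (n + 1) \<cdot> a (n + 1)"] by (simp add: arrow_simps c hh)
    fix i assume i: "i \<in> {1..n}"
    then obtain j where j: "i = Suc j" by (cases i) auto
    have fi: "f i = gadd (Hom D (ob X i) (ob Y i)) (diff Y j \<cdot> h i) (h (Suc i) \<cdot> diff X i)"
      using h(3) i j by auto
    show "b i \<cdot> f i \<cdot> a i =
      gadd (Hom D (ob W i) (ob V i)) (diff V (i - 1) \<cdot> ?l i) (?l (i + 1) \<cdot> diff W i)"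
      unfolding fi using i ad[of i "h (Suc i)"] bd[of j "h i \<cdot> a i"] unfolding j
      by (simp add: additive_simps c hh)
  qed
qed

lemma homotopy_equivalent_sym:
  "homotopy_equivalent n D A C X Y \<Longrightarrow> homotopy_equivalent n D A C Y X"
  unfolding homotopy_equivalent_def by blast

text \<open>
  The homotopy comes from \<open>g g' f' f - 1 = g (g' f' - 1) f + (g f - 1)\<close>.
\<close>

lemma homotopic_Ident_comp:
  assumes X: "is_complex n D X" and Y: "is_complex n D Y" and V: "is_complex n D V"
    and f: "chain_map n D X Y f" and g: "chain_map n D Y X g"
    and f': "chain_map n D Y V f'" and g': "chain_map n D V Y g'"
    and gf: "homotopic n D X X (\<lambda>i. g i \<cdot> f i) (\<lambda>i. Ident D (ob X i))"
    and g'f': "homotopic n D Y Y (\<lambda>i. g' i \<cdot> f' i) (\<lambda>i. Ident D (ob Y i))"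
  shows "homotopic n D X X (\<lambda>i. (g i \<cdot> g' i) \<cdot> (f' i \<cdot> f i)) (\<lambda>i. Ident D (ob X i))"
proof -
  note c = is_complex_arrow[OF X] is_complex_arrow[OF Y] is_complex_arrow[OF V]
    chain_map_arrow(1-3)[OF X Y f] chain_map_arrow(1-3)[OF Y X g]
    chain_map_arrow(1-3)[OF Y V f'] chain_map_arrow(1-3)[OF V Y g']
  have telescope: "gadd (Hom D (ob X i) (ob X i))
      (g i \<cdot> gadd (Hom D (ob Y i) (ob Y i)) (g' i \<cdot> f' i) (gneg (Hom D (ob Y i) (ob Y i)) (Ident D (ob Y i))) \<cdot> f i)
      (gadd (Hom D (ob X i) (ob X i)) (g i \<cdot> f i) (gneg (Hom D (ob X i) (ob X i)) (Ident D (ob X i))))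
    = gadd (Hom D (ob X i) (ob X i)) ((g i \<cdot> g' i) \<cdot> (f' i \<cdot> f i))
        (gneg (Hom D (ob X i) (ob X i)) (Ident D (ob X i)))" if "i \<le> n + 1" for i
  proof -
    have "g i \<cdot> gadd (Hom D (ob Y i) (ob Y i)) (g' i \<cdot> f' i) (gneg (Hom D (ob Y i) (ob Y i)) (Ident D (ob Y i))) \<cdot> f i
      = gadd (Hom D (ob X i) (ob X i)) ((g i \<cdot> g' i) \<cdot> (f' i \<cdot> f i)) (gneg (Hom D (ob X i) (ob X i)) (g i \<cdot> f i))"
      using that by (simp add: additive_simps c)
    then show ?thesis
      using that by (simp only:) (rule gadd_telescope; simp add: additive_simps c)
  qed
  show ?thesis
    unfolding homotopic_def
    by (rule null_homotopic_cong[THEN iffD1, OF telescope null_homotopic_add[OF X X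
          null_homotopic_comp[OF X Y Y X f g'f'[unfolded homotopic_def] g]
          gf[unfolded homotopic_def]]])
qed

lemma homotopy_equivalent_trans:
  assumes "homotopy_equivalent n D A C X Y" "homotopy_equivalent n D A C Y V"
  shows "homotopy_equivalent n D A C X V"
proof -
  obtain f g where XY: "complex_between n D A C X" "complex_between n D A C Y"
    and f: "lift_of n D X Y (Ident D A) (Ident D C) f"
    and g: "lift_of n D Y X (Ident D A) (Ident D C) g"
    and gf: "homotopic n D X X (\<lambda>i. g i \<cdot> f i) (\<lambda>i. Ident D (ob X i))"
    and fg: "homotopic n D Y Y (\<lambda>i. f i \<cdot> g i) (\<lambda>i. Ident D (ob Y i))"
    using assms(1) unfolding homotopy_equivalent_def by blast
  obtain f' g' where V: "complex_between n D A C V"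
    and f': "lift_of n D Y V (Ident D A) (Ident D C) f'"
    and g': "lift_of n D V Y (Ident D A) (Ident D C) g'"
    and g'f': "homotopic n D Y Y (\<lambda>i. g' i \<cdot> f' i) (\<lambda>i. Ident D (ob Y i))"
    and f'g': "homotopic n D V V (\<lambda>i. f' i \<cdot> g' i) (\<lambda>i. Ident D (ob V i))"
    using assms(2) unfolding homotopy_equivalent_def by blast
  have cX: "is_complex n D X" and cY: "is_complex n D Y" and cV: "is_complex n D V"
    using XY V unfolding complex_between_def by auto
  have AC: "A \<in> Obj D" "C \<in> Obj D"
    using XY(1) unfolding complex_between_def is_complex_def by auto
  have cm: "chain_map n D X Y f" "chain_map n D Y X g" "chain_map n D Y V f'" "chain_map n D V Y g'"
    using f g f' g' unfolding lift_of_def by auto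
  have "lift_of n D X V (Ident D A) (Ident D C) (\<lambda>i. f' i \<cdot> f i)"
    using f f' chain_map_comp[OF cX cY cV cm(1,3)] AC unfolding lift_of_def
    by (simp add: arrow_simps)
  moreover have "lift_of n D V X (Ident D A) (Ident D C) (\<lambda>i. g i \<cdot> g' i)"
    using g g' chain_map_comp[OF cV cY cX cm(4,2)] AC unfolding lift_of_def
    by (simp add: arrow_simps)
  moreover note homotopic_Ident_comp[OF cX cY cV cm gf g'f']
    homotopic_Ident_comp[OF cV cY cX cm(4,3,2,1) f'g' fg]
  ultimately show ?thesis using XY V unfolding homotopy_equivalent_def by blast
qed

lemma homotopy_class_eqI:
  assumes "homotopy_equivalent n D A C X Y"
  shows "homotopy_class n D X = homotopy_class n D Y"
proof -
  have "ob X 0 = A" "ob X (n + 1) = C" "ob Y 0 = A" "ob Y (n + 1) = C"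
    using assms unfolding homotopy_equivalent_def complex_between_def by auto
  then show ?thesis
    unfolding homotopy_class_def
    using homotopy_equivalent_trans[OF assms]
      homotopy_equivalent_trans[OF homotopy_equivalent_sym[OF assms]] by auto
qed

lemma null_homotopic_zero:
  assumes X: "is_complex n D X" and Y: "is_complex n D Y"
  shows "null_homotopic n D X Y (\<lambda>i. gzero (Hom D (ob X i) (ob Y i)))"
  unfolding null_homotopic_def
proof (intro exI conjI ballI)
  note a = is_complex_arrow[OF X] is_complex_arrow[OF Y]
  let ?l = "\<lambda>i. gzero (Hom D (ob X i) (ob Y (i - 1)))"
  show "?l i \<in> Mor D (ob X i) (ob Y (i - 1))" if "i \<in> {1..n + 1}" for i
    using that by (cases i) (simp_all add: additive_simps a)
  show "gzero (Hom D (ob X 0) (ob Y 0)) = ?l 1 \<cdot> diff X 0"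
    "gzero (Hom D (ob X (n + 1)) (ob Y (n + 1))) = diff Y n \<cdot> ?l (n + 1)"
    by (simp_all add: additive_simps a)
  fix i assume i: "i \<in> {1..n}"
  then obtain j where j: "i = Suc j" by (cases i) auto
  show "gzero (Hom D (ob X i) (ob Y i)) =
    gadd (Hom D (ob X i) (ob Y i)) (diff Y (i - 1) \<cdot> ?l i) (?l (i + 1) \<cdot> diff X i)"
    using i unfolding j by (simp add: additive_simps a)
qed

text \<open>
  Realisations are only given as homotopy classes. With the transitivity above, this lemma shows
  that a class contains, with a complex, every complex isomorphic to it relative to the ends.
\<close>

lemma isomorphic_homotopy_equivalent:
  assumes X: "complex_between n D A C X" and Y: "complex_between n D A C Y"
    and f: "lift_of n D X Y (Ident D A) (Ident D C) f"
    and g: "lift_of n D Y X (Ident D A) (Ident D C) g"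
    and gf: "\<And>i. i \<le> n + 1 \<Longrightarrow> g i \<cdot> f i = Ident D (ob X i)"
    and fg: "\<And>i. i \<le> n + 1 \<Longrightarrow> f i \<cdot> g i = Ident D (ob Y i)"
  shows "homotopy_equivalent n D A C X Y"
proof -
  have cX: "is_complex n D X" and cY: "is_complex n D Y"
    using X Y unfolding complex_between_def by auto
  have hom: "homotopic n D W W u (\<lambda>i. Ident D (ob W i))"
    if W: "is_complex n D W" and u: "\<And>i. i \<le> n + 1 \<Longrightarrow> u i = Ident D (ob W i)" for W u
    unfolding homotopic_def
    using null_homotopic_zero[OF W W]
    by (rule null_homotopic_cong[THEN iffD1, rotated])
      (simp add: u additive_simps is_complex_arrow[OF W])
  then show ?thesis
    unfolding homotopy_equivalent_def
    using X Y f g hom[OF cX, of "\<lambda>i. g i \<cdot> f i"] hom[OF cY, of "\<lambda>i. f i \<cdot> g i"] gf fg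
    by blast
qed

end

section \<open>Exangles with three terms\<close>

text \<open>
  Weak idempotent completeness in a form that is visibly self-dual: a section is the inclusion of a
  summand, and the given retraction is the projection to it.
\<close>

definition complemented :: "('o, 'm) precat \<Rightarrow> bool" where
  "complemented D \<longleftrightarrow>
     (\<forall>A \<in> Obj D. \<forall>B \<in> Obj D. \<forall>s \<in> Mor D A B. \<forall>p \<in> Mor D B A. p \<cdot>\<^bsub>D\<^esub> s = Ident D A \<longrightarrow>
        (\<exists>K k l. biproduct D A K B s k p l))"

text \<open>
  For complexes \<open>X \<rightarrow> Y \<rightarrow> K\<close>, the notion of
  \<open>1\<close>-exangle without reference to indexed families. In each exact sequence only the
  inclusion of the kernel in the image is listed: the other inclusion follows from the three
  vanishing conditions.
\<close>

definition short_exangle :: "('o, 'm) precat \<Rightarrow> ('o, 'm, 'e) bifun \<Rightarrow>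
    'o \<Rightarrow> 'o \<Rightarrow> 'o \<Rightarrow> 'm \<Rightarrow> 'm \<Rightarrow> 'e \<Rightarrow> bool" where
  "short_exangle D G X Y K f v \<delta> \<longleftrightarrow>
     X \<in> Obj D \<and> Y \<in> Obj D \<and> K \<in> Obj D \<and> f \<in> Mor D X Y \<and> v \<in> Mor D Y K \<and>
     \<delta> \<in> carrier (Ext G K X) \<and>
     v \<cdot>\<^bsub>D\<^esub> f = gzero (Hom D X K) \<and>
     push D G K f \<delta> = gzero (Ext G K Y) \<and> pull D G X v \<delta> = gzero (Ext G Y X) \<and>
     (\<forall>A \<in> Obj D. \<forall>a \<in> Mor D A Y. v \<cdot>\<^bsub>D\<^esub> a = gzero (Hom D A K) \<longrightarrow> (\<exists>b \<in> Mor D A X. a = f \<cdot>\<^bsub>D\<^esub> b)) \<and>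
     (\<forall>A \<in> Obj D. \<forall>a \<in> Mor D A K. pull D G X a \<delta> = gzero (Ext G A X) \<longrightarrow> (\<exists>b \<in> Mor D A Y. a = v \<cdot>\<^bsub>D\<^esub> b)) \<and>
     (\<forall>A \<in> Obj D. \<forall>a \<in> Mor D Y A. a \<cdot>\<^bsub>D\<^esub> f = gzero (Hom D X A) \<longrightarrow> (\<exists>b \<in> Mor D K A. a = b \<cdot>\<^bsub>D\<^esub> v)) \<and>
     (\<forall>A \<in> Obj D. \<forall>a \<in> Mor D X A. push D G K a \<delta> = gzero (Ext G K A) \<longrightarrow> (\<exists>b \<in> Mor D Y A. a = b \<cdot>\<^bsub>D\<^esub> f))"

lemma short_exangle_data:
  assumes "short_exangle D G X Y K f v \<delta>"
  shows "X \<in> Obj D" "Y \<in> Obj D" "K \<in> Obj D" "f \<in> Mor D X Y" "v \<in> Mor D Y K"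
    "\<delta> \<in> carrier (Ext G K X)" "v \<cdot>\<^bsub>D\<^esub> f = gzero (Hom D X K)"
    "push D G K f \<delta> = gzero (Ext G K Y)" "pull D G X v \<delta> = gzero (Ext G Y X)"
  using assms unfolding short_exangle_def by blast+

lemma short_exangle_exact:
  assumes "short_exangle D G X Y K f v \<delta>" and "A \<in> Obj D"
  shows "\<lbrakk>a \<in> Mor D A Y; v \<cdot>\<^bsub>D\<^esub> a = gzero (Hom D A K)\<rbrakk> \<Longrightarrow> \<exists>b \<in> Mor D A X. a = f \<cdot>\<^bsub>D\<^esub> b"
    "\<lbrakk>a \<in> Mor D A K; pull D G X a \<delta> = gzero (Ext G A X)\<rbrakk> \<Longrightarrow> \<exists>b \<in> Mor D A Y. a = v \<cdot>\<^bsub>D\<^esub> b"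
    "\<lbrakk>a \<in> Mor D Y A; a \<cdot>\<^bsub>D\<^esub> f = gzero (Hom D X A)\<rbrakk> \<Longrightarrow> \<exists>b \<in> Mor D K A. a = b \<cdot>\<^bsub>D\<^esub> v"
    "\<lbrakk>a \<in> Mor D X A; push D G K a \<delta> = gzero (Ext G K A)\<rbrakk> \<Longrightarrow> \<exists>b \<in> Mor D Y A. a = b \<cdot>\<^bsub>D\<^esub> f"
  using assms by (simp_all add: short_exangle_def)

context biadditive_functor
begin

lemma pull_closed:
  "\<lbrakk>C \<in> Obj D; C' \<in> Obj D; A \<in> Obj D; c \<in> Mor D C' C; \<delta> \<in> carrier (Ext G C A)\<rbrakk>
    \<Longrightarrow> pull D G A c \<delta> \<in> carrier (Ext G C' A)"
  unfolding pull_def using ExtMap_hom Ident_in_Mor by (meson hom_in_carrier)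

lemma push_closed:
  "\<lbrakk>C \<in> Obj D; A' \<in> Obj D; A \<in> Obj D; a \<in> Mor D A A'; \<delta> \<in> carrier (Ext G C A)\<rbrakk>
    \<Longrightarrow> push D G C a \<delta> \<in> carrier (Ext G C A')"
  unfolding push_def using ExtMap_hom Ident_in_Mor by (meson hom_in_carrier)

lemma pull_Comp:
  "\<lbrakk>C \<in> Obj D; C' \<in> Obj D; C'' \<in> Obj D; A \<in> Obj D; c \<in> Mor D C' C; c' \<in> Mor D C'' C';
    \<delta> \<in> carrier (Ext G C A)\<rbrakk> \<Longrightarrow> pull D G A (c \<cdot> c') \<delta> = pull D G A c' (pull D G A c \<delta>)"
  unfolding pull_def
  using ExtMap_Comp[of C C' C'' A A A c c' "Ident D A" "Ident D A" \<delta>]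
  by (simp add: Ident_in_Mor Ident_Comp[of A A])

lemma push_Comp:
  "\<lbrakk>C \<in> Obj D; A \<in> Obj D; A' \<in> Obj D; A'' \<in> Obj D; a \<in> Mor D A A'; a' \<in> Mor D A' A'';
    \<delta> \<in> carrier (Ext G C A)\<rbrakk> \<Longrightarrow> push D G C (a' \<cdot> a) \<delta> = push D G C a' (push D G C a \<delta>)"
  unfolding push_def
  using ExtMap_Comp[of C C C A A' A'' "Ident D C" "Ident D C" a a' \<delta>]
  by (simp add: Ident_in_Mor Ident_Comp[of C C])

lemma push_pull:
  assumes "C \<in> Obj D" "C' \<in> Obj D" "A \<in> Obj D" "A' \<in> Obj D" "c \<in> Mor D C' C" "a \<in> Mor D A A'"
    "\<delta> \<in> carrier (Ext G C A)"
  shows "push D G C' a (pull D G A c \<delta>) = pull D G A' c (push D G C a \<delta>)"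
  unfolding push_def pull_def
  using assms ExtMap_Comp[of C C' C' A A A' c "Ident D C'" "Ident D A" a \<delta>]
    ExtMap_Comp[of C C C' A A' A' "Ident D C" c a "Ident D A'" \<delta>]
  by (simp add: arrow_simps)

lemma pull_gadd:
  "\<lbrakk>C \<in> Obj D; C' \<in> Obj D; A \<in> Obj D; c \<in> Mor D C' C; c' \<in> Mor D C' C; \<delta> \<in> carrier (Ext G C A)\<rbrakk>
    \<Longrightarrow> pull D G A (gadd (Hom D C' C) c c') \<delta>
      = gadd (Ext G C' A) (pull D G A c \<delta>) (pull D G A c' \<delta>)"
  unfolding pull_def using ExtMap_add_left Ident_in_Mor by blast

lemma pull_Ident: "\<lbrakk>C \<in> Obj D; A \<in> Obj D; \<delta> \<in> carrier (Ext G C A)\<rbrakk> \<Longrightarrow> pull D G A (Ident D C) \<delta> = \<delta>"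
  unfolding pull_def by (rule ExtMap_Ident)

lemma push_Ident: "\<lbrakk>C \<in> Obj D; A \<in> Obj D; \<delta> \<in> carrier (Ext G C A)\<rbrakk> \<Longrightarrow> push D G C (Ident D A) \<delta> = \<delta>"
  unfolding push_def by (rule ExtMap_Ident)

lemma Ext_group: "\<lbrakk>C \<in> Obj D; A \<in> Obj D\<rbrakk> \<Longrightarrow> group (Ext G C A)"
  using Ext_comm_group comm_group.axioms(2) by blast

lemma pull_gzero:
  "\<lbrakk>C \<in> Obj D; C' \<in> Obj D; A \<in> Obj D; c \<in> Mor D C' C\<rbrakk>
    \<Longrightarrow> pull D G A c (gzero (Ext G C A)) = gzero (Ext G C' A)"
  unfolding pull_def using ExtMap_hom[of C C' A A c] Ident_in_Mor Ext_group
  by (blast intro: hom_one)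

lemma push_gzero:
  "\<lbrakk>C \<in> Obj D; A \<in> Obj D; A' \<in> Obj D; a \<in> Mor D A A'\<rbrakk>
    \<Longrightarrow> push D G C a (gzero (Ext G C A)) = gzero (Ext G C A')"
  unfolding push_def using ExtMap_hom[of C C A A' _ a] Ident_in_Mor Ext_group
  by (blast intro: hom_one)

text \<open>
  The maps \<open>e\<close> and \<open>z\<close> identify \<open>P\<close> with
  \<open>Y \<oplus> Z\<close>, while \<open>d z\<close> and \<open>k\<close> identify
  \<open>W\<close> with \<open>Z \<oplus> K\<close>. In these coordinates \<open>d\<close> is
  diagonal, so \<open>X \<rightarrow> P \<rightarrow> W\<close> is the sum of
  \<open>X \<rightarrow> Y \<rightarrow> K\<close> and the split complex
  \<open>0 \<rightarrow> Z \<rightarrow> Z\<close>. XX This is what carries exactness over from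
  \<open>\<delta>\<close> to \<open>k\<^sup>*\<delta>\<close>.
\<close>

lemma short_exangle_retract:
  assumes ex: "short_exangle D G X P W (e \<cdot> f) d \<delta>"
    and f: "f \<in> Mor D X Y"
    and P: "biproduct D Y Z P e z p w"
    and q: "q \<in> Mor D W Z" and qd: "q \<cdot> d = w"
    and W: "biproduct D Z K W (d \<cdot> z) k q l"
  shows "short_exangle D G X Y K f (l \<cdot> d \<cdot> e) (pull D G X k \<delta>)"
    and "k \<cdot> l \<cdot> d \<cdot> e = d \<cdot> e"
proof -
  let ?\<delta> = "pull D G X k \<delta>"
  note [simp] = biproduct_arrow(1-3)[OF P] biproduct_arrow(2)[OF W]
  have XW: "X \<in> Obj D" "W \<in> Obj D" and d: "d \<in> Mor D P W" and \<delta>: "\<delta> \<in> carrier (Ext G W X)"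
    and def0: "d \<cdot> e \<cdot> f = gzero (Hom D X W)" and ef_\<delta>: "push D G W (e \<cdot> f) \<delta> = gzero (Ext G W P)"
    and d_\<delta>: "pull D G X d \<delta> = gzero (Ext G P X)"
    using short_exangle_data[OF ex] by auto
  note [simp] = XW \<delta>
  have [simp]: "arrow f" "src f = X" "tgt f = Y" "arrow e" "src e = Y" "tgt e = P"
    "arrow z" "src z = Z" "tgt z = P" "arrow p" "src p = P" "tgt p = Y"
    "arrow w" "src w = P" "tgt w = Z" "arrow q" "src q = W" "tgt q = Z"
    "arrow d" "src d = P" "tgt d = W" "arrow k" "src k = K" "tgt k = W" "arrow l" "src l = W" "tgt l = K"
    using f q d biproduct_arrow[OF P] biproduct_arrow[OF W] by (simp_all add: Mor_iff)
  note P_eq = biproduct_arrow(8-12)[OF P] and W_eq = biproduct_arrow(8-12)[OF W]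
  have qd': "q \<cdot> d \<cdot> x = w \<cdot> x" if "arrow x" "tgt x = P" for x
    using that qd Comp_arrow_assoc[of x d q] by simp
  have we': "w \<cdot> e \<cdot> x = gzero (Hom D (src x) Z)" if "arrow x" "tgt x = Y" for x
    using that P_eq Comp_arrow_assoc[of x e w] by (simp add: additive_simps)
  have pe': "p \<cdot> e \<cdot> x = x" if "arrow x" "tgt x = Y" for x
    using that P_eq Comp_arrow_assoc[of x e p] by (simp add: additive_simps)
  have lk': "l \<cdot> k \<cdot> x = x" if "arrow x" "tgt x = K" for x
    using that W_eq Comp_arrow_assoc[of x k l] by (simp add: additive_simps)
  have kl: "k \<cdot> l \<cdot> x = x" if x: "arrow x" "tgt x = W" "q \<cdot> x = gzero (Hom D (src x) Z)" for x
  proof -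
    have "gadd (Hom D W W) ((d \<cdot> z) \<cdot> q) (k \<cdot> l) \<cdot> x = x" using W_eq(5) x by (simp add: arrow_simps)
    then show ?thesis using x by (simp add: additive_simps)
  qed
  have kv: "k \<cdot> l \<cdot> d \<cdot> e = d \<cdot> e"
    by (rule kl) (simp_all add: qd' P_eq arrow_simps)
  then show "k \<cdot> l \<cdot> d \<cdot> e = d \<cdot> e" .
  have dzq: "pull D G X ((d \<cdot> z) \<cdot> q) \<delta> = gzero (Ext G W X)"
    using pull_Comp[of W P W X d "z \<cdot> q" \<delta>] d_\<delta> pull_gzero[of P W X "z \<cdot> q"] by (simp add: arrow_simps)
  have \<delta>_eq: "\<delta> = pull D G X l ?\<delta>"
  proof -
    interpret H: group "Ext G W X" using Ext_group by simp
    have "\<delta> = pull D G X (gadd (Hom D W W) ((d \<cdot> z) \<cdot> q) (k \<cdot> l)) \<delta>"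
      using W_eq(5) pull_Ident by simp
    also have "\<dots> = gadd (Ext G W X) (pull D G X ((d \<cdot> z) \<cdot> q) \<delta>) (pull D G X (k \<cdot> l) \<delta>)"
      by (rule pull_gadd) (simp_all add: arrow_simps)
    also have "\<dots> = pull D G X (k \<cdot> l) \<delta>"
      unfolding dzq by (rule H.l_one) (simp add: pull_closed[of W] arrow_simps)
    also have "\<dots> = pull D G X l ?\<delta>"
      by (rule pull_Comp[of W K W]) (simp_all add: arrow_simps)
    finally show ?thesis .
  qed
  have \<delta>'[simp]: "?\<delta> \<in> carrier (Ext G K X)" by (rule pull_closed[of W]) (simp_all add: arrow_simps)
  have f_\<delta>: "push D G W f \<delta> = gzero (Ext G W Y)"
    using push_Comp[of W X P Y "e \<cdot> f" p \<delta>] ef_\<delta> push_gzero[of W P Y p]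
    by (simp add: arrow_simps pe')
  show "short_exangle D G X Y K f (l \<cdot> d \<cdot> e) ?\<delta>"
    unfolding short_exangle_def
  proof (intro conjI ballI impI)
    show "(l \<cdot> d \<cdot> e) \<cdot> f = gzero (Hom D X K)" using def0 by (simp add: additive_simps)
    show "push D G K f ?\<delta> = gzero (Ext G K Y)"
      using push_pull[of W K X Y k f \<delta>] pull_gzero[of W K Y k] f_\<delta> by (simp add: Mor_iff)
    have "pull D G X (l \<cdot> d \<cdot> e) ?\<delta> = pull D G X (k \<cdot> l \<cdot> d \<cdot> e) \<delta>"
      by (rule pull_Comp[of W K Y, symmetric]) (simp_all add: arrow_simps)
    also have "\<dots> = pull D G X e (pull D G X d \<delta>)"
      unfolding kv by (rule pull_Comp[of W P Y]) (simp_all add: arrow_simps)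
    also have "\<dots> = gzero (Ext G Y X)"
      unfolding d_\<delta> by (rule pull_gzero) (simp_all add: arrow_simps)
    finally show "pull D G X (l \<cdot> d \<cdot> e) ?\<delta> = gzero (Ext G Y X)" .
  next
    fix A a assume A[simp]: "A \<in> Obj D" and a: "a \<in> Mor D A Y"
      and 0: "(l \<cdot> d \<cdot> e) \<cdot> a = gzero (Hom D A K)"
    have [simp]: "arrow a" "src a = A" "tgt a = Y" using a by (simp_all add: Mor_iff)
    have "d \<cdot> e \<cdot> a = (k \<cdot> l \<cdot> d \<cdot> e) \<cdot> a" unfolding kv by (simp add: arrow_simps)
    also have "\<dots> = k \<cdot> ((l \<cdot> d \<cdot> e) \<cdot> a)" by (simp add: arrow_simps)
    also have "\<dots> = gzero (Hom D A W)" unfolding 0 by (simp add: additive_simps)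
    finally have "d \<cdot> e \<cdot> a = gzero (Hom D A W)" .
    moreover have "e \<cdot> a \<in> Mor D A P" by (simp add: arrow_simps)
    ultimately obtain b where b: "b \<in> Mor D A X" "e \<cdot> a = (e \<cdot> f) \<cdot> b"
      using short_exangle_exact(1)[OF ex A] by blast
    have [simp]: "arrow b" "src b = A" "tgt b = X" using b by (simp_all add: Mor_iff)
    have "p \<cdot> e \<cdot> a = p \<cdot> e \<cdot> f \<cdot> b" using b by (simp add: arrow_simps)
    then have "a = f \<cdot> b" by (simp add: pe' arrow_simps)
    then show "\<exists>b \<in> Mor D A X. a = f \<cdot> b" using b by blast
  next
    fix A a assume A[simp]: "A \<in> Obj D" and a: "a \<in> Mor D A K"
      and 0: "pull D G X a ?\<delta> = gzero (Ext G A X)"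
    have [simp]: "arrow a" "src a = A" "tgt a = K" using a by (simp_all add: Mor_iff)
    have "pull D G X (k \<cdot> a) \<delta> = gzero (Ext G A X)"
      using 0 pull_Comp[of W K A X k a \<delta>] by (simp add: arrow_simps)
    moreover have "k \<cdot> a \<in> Mor D A W" by (simp add: arrow_simps)
    ultimately obtain b where b: "b \<in> Mor D A P" "k \<cdot> a = d \<cdot> b"
      using short_exangle_exact(2)[OF ex A] by blast
    have [simp]: "arrow b" "src b = A" "tgt b = P" using b by (simp_all add: Mor_iff)
    have "q \<cdot> k \<cdot> a = gzero (Hom D A Z)"
      using W_eq(3) Comp_arrow_assoc[of a k q] by (simp add: additive_simps)
    then have wb: "w \<cdot> b = gzero (Hom D A Z)" using b qd'[of b] by simp
    have "gadd (Hom D P P) (e \<cdot> p) (z \<cdot> w) \<cdot> b = b" using P_eq(5) by (simp add: arrow_simps)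
    then have epb: "e \<cdot> p \<cdot> b = b" by (simp add: additive_simps wb)
    have "a = l \<cdot> d \<cdot> b" using lk'[of a] b by simp
    then have "a = (l \<cdot> d \<cdot> e) \<cdot> (p \<cdot> b)" using epb by (simp add: arrow_simps)
    moreover have "p \<cdot> b \<in> Mor D A Y" by (simp add: arrow_simps)
    ultimately show "\<exists>b \<in> Mor D A Y. a = (l \<cdot> d \<cdot> e) \<cdot> b" by blast
  next
    fix A a assume A[simp]: "A \<in> Obj D" and a: "a \<in> Mor D Y A"
      and 0: "a \<cdot> f = gzero (Hom D X A)"
    have [simp]: "arrow a" "src a = Y" "tgt a = A" using a by (simp_all add: Mor_iff)
    have "(a \<cdot> p) \<cdot> e \<cdot> f = gzero (Hom D X A)" using 0 by (simp add: arrow_simps pe')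
    moreover have "a \<cdot> p \<in> Mor D P A" by (simp add: arrow_simps)
    ultimately obtain b where b: "b \<in> Mor D W A" "a \<cdot> p = b \<cdot> d"
      using short_exangle_exact(3)[OF ex A] by blast
    have [simp]: "arrow b" "src b = W" "tgt b = A" using b by (simp_all add: Mor_iff)
    have "a = (a \<cdot> p) \<cdot> e" using P_eq by (simp add: arrow_simps)
    also have "\<dots> = b \<cdot> k \<cdot> l \<cdot> d \<cdot> e" unfolding b kv by (simp add: arrow_simps)
    finally have "a = (b \<cdot> k) \<cdot> (l \<cdot> d \<cdot> e)" by (simp add: arrow_simps)
    moreover have "b \<cdot> k \<in> Mor D K A" by (simp add: arrow_simps)
    ultimately show "\<exists>b \<in> Mor D K A. a = b \<cdot> (l \<cdot> d \<cdot> e)" by blast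
  next
    fix A a assume A[simp]: "A \<in> Obj D" and a: "a \<in> Mor D X A"
      and 0: "push D G K a ?\<delta> = gzero (Ext G K A)"
    have [simp]: "arrow a" "src a = X" "tgt a = A" using a by (simp_all add: Mor_iff)
    have "push D G W a (pull D G X l ?\<delta>) = gzero (Ext G W A)"
      using push_pull[of K W X A l a ?\<delta>] 0 pull_gzero[of K W A l] by (simp add: Mor_iff)
    then have "push D G W a \<delta> = gzero (Ext G W A)" using \<delta>_eq by simp
    then obtain b where b: "b \<in> Mor D P A" "a = b \<cdot> e \<cdot> f"
      using short_exangle_exact(4)[OF ex A a] by blast
    have [simp]: "arrow b" "src b = P" "tgt b = A" using b by (simp_all add: Mor_iff)
    have "a = (b \<cdot> e) \<cdot> f" using b by (simp add: arrow_simps)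
    moreover have "b \<cdot> e \<in> Mor D Y A" by (simp add: arrow_simps)
    ultimately show "\<exists>b \<in> Mor D Y A. a = b \<cdot> f" by blast
  qed (simp_all add: arrow_simps)
qed

text \<open>
  The four lemma, once for covariant and once for contravariant hom functors. As
  \<open>v\<^sup>*\<delta> = 0\<close>, exactness of \<open>E'\<close> lifts \<open>v\<close> to
  some \<open>m : Y \<rightarrow> Y'\<close>; then \<open>1 - t m\<close> is killed by
  \<open>v\<close>, and a correction through \<open>X\<close> turns \<open>m\<close> into a right
  inverse of \<open>t\<close>. Extending \<open>x\<close> along \<open>f\<close> gives a left
  inverse in the dual way.
\<close>

lemma short_exangle_comparison_iso:
  assumes E: "short_exangle D G X Y K f v \<delta>" and E': "short_exangle D G X Y' K x y \<delta>"
    and t: "t \<in> Mor D Y' Y" and tx: "t \<cdot> x = f" and vt: "v \<cdot> t = y"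
  obtains r where "r \<in> Mor D Y Y'" "r \<cdot> t = Ident D Y'" "t \<cdot> r = Ident D Y"
proof -
  have ob[simp]: "X \<in> Obj D" "Y \<in> Obj D" "Y' \<in> Obj D" "K \<in> Obj D"
    using short_exangle_data[OF E] short_exangle_data[OF E'] by auto
  have [simp]: "arrow f" "src f = X" "tgt f = Y" "arrow v" "src v = Y" "tgt v = K"
    "arrow x" "src x = X" "tgt x = Y'" "arrow y" "src y = Y'" "tgt y = K"
    "arrow t" "src t = Y'" "tgt t = Y"
    using short_exangle_data(4,5)[OF E] short_exangle_data(4,5)[OF E'] t by (simp_all add: Mor_iff)
  obtain m where m: "m \<in> Mor D Y Y'" "v = y \<cdot> m"
  proof -
    have "v \<in> Mor D Y K" "pull D G X v \<delta> = gzero (Ext G Y X)"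
      using short_exangle_data[OF E] by auto
    then show ?thesis using short_exangle_exact(2)[OF E' ob(2)] that by blast
  qed
  obtain m' where m': "m' \<in> Mor D Y Y'" "x = m' \<cdot> f"
  proof -
    have "x \<in> Mor D X Y'" "push D G K x \<delta> = gzero (Ext G K Y')"
      using short_exangle_data[OF E'] by auto
    then show ?thesis using short_exangle_exact(4)[OF E ob(3)] that by blast
  qed
  have [simp]: "arrow m" "src m = Y" "tgt m = Y'" "arrow m'" "src m' = Y" "tgt m' = Y'"
    using m m' by (simp_all add: Mor_iff)
  have "v \<cdot> t \<cdot> m = (v \<cdot> t) \<cdot> m" by (simp add: arrow_simps)
  then have vtm: "v \<cdot> t \<cdot> m = v" unfolding vt m(2)[symmetric] .
  have mtx: "m' \<cdot> t \<cdot> x = x" unfolding tx m'(2)[symmetric] ..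
  obtain n where n: "n \<in> Mor D Y X"
    "gadd (Hom D Y Y) (Ident D Y) (gneg (Hom D Y Y) (t \<cdot> m)) = f \<cdot> n"
  proof -
    have "v \<cdot> gadd (Hom D Y Y) (Ident D Y) (gneg (Hom D Y Y) (t \<cdot> m)) = gzero (Hom D Y K)"
      by (simp add: additive_simps vtm)
    moreover have "gadd (Hom D Y Y) (Ident D Y) (gneg (Hom D Y Y) (t \<cdot> m)) \<in> Mor D Y Y"
      by (simp add: additive_simps)
    ultimately show ?thesis using short_exangle_exact(1)[OF E ob(2)] that by blast
  qed
  obtain n' where n': "n' \<in> Mor D K Y'"
    "gadd (Hom D Y' Y') (Ident D Y') (gneg (Hom D Y' Y') (m' \<cdot> t)) = n' \<cdot> y"
  proof -
    have "gadd (Hom D Y' Y') (Ident D Y') (gneg (Hom D Y' Y') (m' \<cdot> t)) \<cdot> x = gzero (Hom D X Y')"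
      by (simp add: additive_simps mtx)
    moreover have "gadd (Hom D Y' Y') (Ident D Y') (gneg (Hom D Y' Y') (m' \<cdot> t)) \<in> Mor D Y' Y'"
      by (simp add: additive_simps)
    ultimately show ?thesis using short_exangle_exact(3)[OF E' ob(3)] that by blast
  qed
  have [simp]: "arrow n" "src n = Y" "tgt n = X" "arrow n'" "src n' = K" "tgt n' = Y'"
    using n n' by (simp_all add: Mor_iff)
  let ?r = "gadd (Hom D Y Y') (x \<cdot> n) m" and ?l = "gadd (Hom D Y Y') (n' \<cdot> v) m'"
  have "t \<cdot> x \<cdot> n = f \<cdot> n" using tx Comp_arrow_assoc[of n x t] by simp
  then have tr: "t \<cdot> ?r = Ident D Y"
    using eq_if_diff_zero[OF _ _ _ _ n(2)] by (simp add: additive_simps)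
  have lt: "?l \<cdot> t = Ident D Y'"
    using eq_if_diff_zero[OF _ _ _ _ n'(2)] vt by (simp add: additive_simps)
  have r: "?r \<in> Mor D Y Y'" "?l \<in> Mor D Y Y'" by (simp_all add: additive_simps)
  then have "?l \<cdot> t \<cdot> ?r = (?l \<cdot> t) \<cdot> ?r" by (simp add: Comp_arrow_assoc Mor_iff)
  then have "?l = ?r" unfolding tr lt using r by (simp add: arrow_simps)
  then show ?thesis using that r tr lt by metis
qed

text \<open>
  A section of \<open>v\<close> forces \<open>\<delta> = s\<^sup>*v\<^sup>*\<delta> = 0\<close>.
  Then the identity of \<open>X\<close> extends along \<open>f\<close>, so \<open>f\<close> is
  monic and the factorisations through it are unique.
\<close>

lemma short_exangle_split_kernel:
  assumes ex: "short_exangle D G X Y K f v \<delta>"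
    and s: "s \<in> Mor D K Y" and vs: "v \<cdot> s = Ident D K"
  shows "kernel_of D Y K v X f"
proof -
  note E = short_exangle_data[OF ex]
  have "\<delta> = pull D G X (v \<cdot> s) \<delta>" unfolding vs using pull_Ident E by simp
  also have "\<dots> = pull D G X s (pull D G X v \<delta>)" using E s by (intro pull_Comp[of K Y K]) auto
  also have "\<dots> = gzero (Ext G K X)" unfolding E(9) using E s by (intro pull_gzero) auto
  finally have "push D G K (Ident D X) \<delta> = gzero (Ext G K X)" using push_Ident E by simp
  then obtain m where m: "m \<in> Mor D Y X" "Ident D X = m \<cdot> f"
    using short_exangle_exact(4)[OF ex E(1) Ident_in_Mor[OF E(1)]] by blast
  have mono: "x = y" if A: "A \<in> Obj D" and x: "x \<in> Mor D A X" and y: "y \<in> Mor D A X"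
    and fxy: "f \<cdot> x = f \<cdot> y" for A x y
  proof -
    have "x = (m \<cdot> f) \<cdot> x" unfolding m(2)[symmetric] using E A x by (simp add: Ident_Comp)
    also have "\<dots> = m \<cdot> (f \<cdot> x)" using Comp_assoc[OF A E(1,2,1) x E(4) m(1)] .
    also have "\<dots> = (m \<cdot> f) \<cdot> y" unfolding fxy using Comp_assoc[OF A E(1,2,1) y E(4) m(1)] ..
    also have "\<dots> = y" unfolding m(2)[symmetric] using E A y by (simp add: Ident_Comp)
    finally show ?thesis .
  qed
  show ?thesis
    unfolding kernel_of_def
  proof (intro conjI ballI impI)
    fix A w assume A: "A \<in> Obj D" and w: "w \<in> Mor D A Y" "v \<cdot> w = gzero (Hom D A K)"
    then obtain b where "b \<in> Mor D A X" "w = f \<cdot> b" using short_exangle_exact(1)[OF ex A] by blast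
    then show "\<exists>!u. u \<in> Mor D A X \<and> f \<cdot> u = w" using mono[OF A] by blast
  qed (use E in auto)
qed

end

section \<open>Cancellation of morphisms in conflations\<close>

text \<open>
  The properties of the conflations of an extriangulated category on which the cancellation of
  morphisms rests. The list is self-dual: the last two axioms, which are consequences of pushing
  out and pulling back, are exchanged in the opposite category and each of the others is dual to
  itself.
\<close>

locale conflation_structure = biadditive_functor D G
  for D :: "('o, 'm) precat" (structure) and G :: "('o, 'm, 'e) bifun" +
  fixes conf :: "'o \<Rightarrow> 'o \<Rightarrow> 'o \<Rightarrow> 'm \<Rightarrow> 'm \<Rightarrow> 'e \<Rightarrow> bool"
  assumes conf_exangle: "conf X Y K f v \<delta> \<Longrightarrow> short_exangle D G X Y K f v \<delta>"
    and conf_exists: "\<lbrakk>X \<in> Obj D; K \<in> Obj D; \<delta> \<in> carrier (Ext G K X)\<rbrakk> \<Longrightarrow> \<exists>Y f v. conf X Y K f v \<delta>"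
    and conf_lift: "\<lbrakk>conf X Y K f v \<delta>; conf X' Y' K' f' v' \<delta>'; a \<in> Mor D X X'; c \<in> Mor D K K';
        push D G K a \<delta> = pull D G X' c \<delta>'\<rbrakk> \<Longrightarrow> \<exists>b \<in> Mor D Y Y'. b \<cdot> f = f' \<cdot> a \<and> v' \<cdot> b = c \<cdot> v"
    and conf_iso: "\<lbrakk>conf X Y K f v \<delta>; Y' \<in> Obj D; t \<in> Mor D Y Y'; t' \<in> Mor D Y' Y;
        t' \<cdot> t = Ident D Y; t \<cdot> t' = Ident D Y'\<rbrakk> \<Longrightarrow> conf X Y' K (t \<cdot> f) (v \<cdot> t') \<delta>"
    and conf_cocone: "\<lbrakk>conf X Z C h d \<delta>; Y \<in> Obj D; f \<in> Mor D X Y\<rbrakk> \<Longrightarrow>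
        \<exists>P i j p q W d' \<delta>'. biproduct D Z Y P i j p q \<and>
          conf X P W (gadd (Hom D X P) (i \<cdot> h) (j \<cdot> f)) d' \<delta>'"
    and conf_cone: "\<lbrakk>conf C Z X d h \<delta>; Y \<in> Obj D; f \<in> Mor D Y X\<rbrakk> \<Longrightarrow>
        \<exists>P i j p q W d' \<delta>'. biproduct D Z Y P i j p q \<and>
          conf W P X d' (gadd (Hom D P X) (h \<cdot> p) (f \<cdot> q)) \<delta>'"
begin

text \<open>
  Split off the complement of \<open>Y\<close> from \<open>P\<close> and from \<open>W\<close>, and
  compare the resulting exangle with a realisation of its extension.
\<close>

lemma conf_section_cancel:
  assumes comp: "complemented D"
    and ef: "conf X P W (e \<cdot> f) d \<delta>"
    and Y: "Y \<in> Obj D" and f: "f \<in> Mor D X Y" and e: "e \<in> Mor D Y P" and p: "p \<in> Mor D P Y"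
    and pe: "p \<cdot> e = Ident D Y"
  shows "\<exists>K v \<delta>'. conf X Y K f v \<delta>'"
proof -
  have ex: "short_exangle D G X P W (e \<cdot> f) d \<delta>" using ef conf_exangle by blast
  then have ob[simp]: "X \<in> Obj D" "P \<in> Obj D" "W \<in> Obj D" "Y \<in> Obj D"
    and d: "d \<in> Mor D P W" and \<delta>: "\<delta> \<in> carrier (Ext G W X)"
    using Y short_exangle_data[OF ex] by auto
  obtain Z z w where P: "biproduct D Y Z P e z p w"
    using comp ob e p pe unfolding complemented_def by blast
  note [simp] = biproduct_arrow(2)[OF P]
  note P_eq = biproduct_arrow(8-12)[OF P]
  have [simp]: "arrow f" "src f = X" "tgt f = Y" "arrow e" "src e = Y" "tgt e = P"
    "arrow z" "src z = Z" "tgt z = P" "arrow p" "src p = P" "tgt p = Y"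
    "arrow w" "src w = P" "tgt w = Z" "arrow d" "src d = P" "tgt d = W"
    using f d biproduct_arrow[OF P] by (simp_all add: Mor_iff)
  \<comment> \<open>The projection to \<open>Z\<close> factors through \<open>d\<close>, so \<open>d z\<close> is a section of the factor \<open>q\<close>.\<close>
  have "w \<cdot> e \<cdot> f = gzero (Hom D X Z)"
    using P_eq Comp_arrow_assoc[of f e w] by (simp add: additive_simps)
  moreover have "w \<in> Mor D P Z" "Z \<in> Obj D" by (simp_all add: Mor_iff)
  ultimately obtain q where q: "q \<in> Mor D W Z" and wqd: "w = q \<cdot> d"
    using short_exangle_exact(3)[OF ex, of Z w] by blast
  have [simp]: "arrow q" "src q = W" "tgt q = Z" using q by (simp_all add: Mor_iff)
  have "q \<cdot> d \<cdot> z = Ident D Z" using P_eq(2) wqd by (simp add: arrow_simps)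
  moreover have "d \<cdot> z \<in> Mor D Z W" by (simp add: arrow_simps)
  ultimately obtain K k l where W: "biproduct D Z K W (d \<cdot> z) k q l"
    using comp q \<open>Z \<in> Obj D\<close> ob unfolding complemented_def by blast
  note [simp] = biproduct_arrow(2)[OF W]
  have [simp]: "arrow k" "src k = K" "tgt k = W" "arrow l" "src l = W" "tgt l = K"
    using biproduct_arrow[OF W] by (simp_all add: Mor_iff)
  note W_eq = biproduct_arrow(8-12)[OF W]
  let ?v = "l \<cdot> d \<cdot> e" and ?\<delta> = "pull D G X k \<delta>"
  have exY: "short_exangle D G X Y K f ?v ?\<delta>" and kv: "k \<cdot> ?v = d \<cdot> e"
    using short_exangle_retract[OF ex f P q wqd[symmetric] W] by auto
  have \<delta>': "?\<delta> \<in> carrier (Ext G K X)" using exY by (rule short_exangle_data)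
  then obtain Y' x y where conf': "conf X Y' K x y ?\<delta>" 
    using conf_exists[OF _ _ \<delta>'] biproduct_arrow(2)[OF W] ob by blast
  then have exY': "short_exangle D G X Y' K x y ?\<delta>" by (rule conf_exangle)
  then have [simp]: "Y' \<in> Obj D" "arrow x" "src x = X" "tgt x = Y'" "arrow y" "src y = Y'" "tgt y = K"
    using short_exangle_data(2,4,5)[OF exY'] by (simp_all add: Mor_iff)
  obtain t where t: "t \<in> Mor D Y' P" and tx: "t \<cdot> x = (e \<cdot> f) \<cdot> Ident D X" and dt: "d \<cdot> t = k \<cdot> y"
    using conf_lift[OF conf' ef, of "Ident D X" k] push_Ident[OF _ _ \<delta>'] by (auto simp: arrow_simps)
  have [simp]: "arrow t" "src t = Y'" "tgt t = P" using t by (simp_all add: Mor_iff)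
  have ptx: "(p \<cdot> t) \<cdot> x = f"
    using tx Comp_arrow_assoc[of f e p] pe by (simp add: arrow_simps)
  have "w \<cdot> t = q \<cdot> k \<cdot> y" unfolding wqd using dt by (simp add: arrow_simps)
  also have "\<dots> = gzero (Hom D Y' Z)"
    using W_eq(3) Comp_arrow_assoc[of y k q] by (simp add: additive_simps)
  finally have wt: "w \<cdot> t = gzero (Hom D Y' Z)" .
  \<comment> \<open>The lift \<open>t\<close> has no component in \<open>Z\<close>, so projecting it to \<open>Y\<close> loses nothing.\<close>
  have "gadd (Hom D P P) (e \<cdot> p) (z \<cdot> w) \<cdot> t = t" using P_eq(5) by (simp add: arrow_simps)
  then have ept: "e \<cdot> p \<cdot> t = t" by (simp add: additive_simps wt)
  have "l \<cdot> k \<cdot> y = y" using W_eq(2) Comp_arrow_assoc[of y k l] by (simp add: arrow_simps)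
  then have vpt: "?v \<cdot> (p \<cdot> t) = y" using ept dt by (simp add: arrow_simps)
  have "p \<cdot> t \<in> Mor D Y' Y" by (simp add: arrow_simps)
  then obtain r where r: "r \<in> Mor D Y Y'" "r \<cdot> (p \<cdot> t) = Ident D Y'" "(p \<cdot> t) \<cdot> r = Ident D Y"
    using short_exangle_comparison_iso[OF exY exY' _ ptx vpt] by blast
  have [simp]: "arrow r" "src r = Y" "tgt r = Y'" using r by (simp_all add: Mor_iff)
  have "conf X Y K ((p \<cdot> t) \<cdot> x) (y \<cdot> r) ?\<delta>"
    using conf_iso[OF conf' _ _ r] by (simp add: arrow_simps)
  then show ?thesis unfolding ptx by blast
qed

text \<open>
  The map \<open>(g f, f)\<close> into \<open>Z \<oplus> Y\<close> equals \<open>(g, 1) f\<close>,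
  and \<open>(g, 1)\<close> is a section of the projection to \<open>Y\<close>.
\<close>

lemma conf_comp_cancel:
  assumes comp: "complemented D"
    and gf: "conf X Z C (g \<cdot> f) d \<delta>"
    and Y: "Y \<in> Obj D" and f: "f \<in> Mor D X Y" and g: "g \<in> Mor D Y Z"
  shows "\<exists>K v \<delta>'. conf X Y K f v \<delta>'"
proof -
  have ob[simp]: "X \<in> Obj D" "Y \<in> Obj D" "Z \<in> Obj D"
    using short_exangle_data[OF conf_exangle[OF gf]] Y by auto
  obtain P i j p q W d' \<delta>' where P: "biproduct D Z Y P i j p q"
    and c: "conf X P W (gadd (Hom D X P) (i \<cdot> g \<cdot> f) (j \<cdot> f)) d' \<delta>'"
    using conf_cocone[OF gf Y f] by blast
  note P_eq = biproduct_arrow(8-12)[OF P] and [simp] = biproduct_arrow(3)[OF P]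
  have [simp]: "arrow i" "src i = Z" "tgt i = P" "arrow j" "src j = Y" "tgt j = P"
    "arrow p" "src p = P" "tgt p = Z" "arrow q" "src q = P" "tgt q = Y"
    "arrow f" "src f = X" "tgt f = Y" "arrow g" "src g = Y" "tgt g = Z"
    using biproduct_arrow[OF P] f g by (simp_all add: Mor_iff)
  let ?e = "gadd (Hom D Y P) (i \<cdot> g) j"
  have "?e \<cdot> f = gadd (Hom D X P) (i \<cdot> g \<cdot> f) (j \<cdot> f)" by (simp add: additive_simps)
  then have c': "conf X P W (?e \<cdot> f) d' \<delta>'" using c by simp
  have "q \<cdot> i \<cdot> g = gzero (Hom D Y Y)"
    using P_eq(4) Comp_arrow_assoc[of g i q] by (simp add: additive_simps)
  then have qe: "q \<cdot> ?e = Ident D Y" using P_eq(2) by (simp add: additive_simps)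
  show ?thesis
    by (rule conf_section_cancel[OF comp c' Y f _ _ qe]) (simp_all add: additive_simps)
qed

end

section \<open>Duality\<close>

definition op_cat :: "('o, 'm) precat \<Rightarrow> ('o, 'm) precat" where
  "op_cat D = \<lparr>Obj = Obj D, Hom = (\<lambda>A B. Hom D B A), Ident = Ident D, Comp = (\<lambda>g f. f \<cdot>\<^bsub>D\<^esub> g)\<rparr>"

definition op_bifun :: "('o, 'm, 'e) bifun \<Rightarrow> ('o, 'm, 'e) bifun" where
  "op_bifun G = \<lparr>Ext = (\<lambda>C A. Ext G A C), ExtMap = (\<lambda>c a. ExtMap G a c)\<rparr>"

lemma op_sel [simp]:
  "Obj (op_cat D) = Obj D" "Hom (op_cat D) A B = Hom D B A" "Ident (op_cat D) = Ident D"
  "g \<cdot>\<^bsub>op_cat D\<^esub> f = f \<cdot>\<^bsub>D\<^esub> g" "Ext (op_bifun G) C A = Ext G A C"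
  "ExtMap (op_bifun G) c a = ExtMap G a c"
  "push (op_cat D) (op_bifun G) C a \<delta> = pull D G C a \<delta>"
  "pull (op_cat D) (op_bifun G) A c \<delta> = push D G A c \<delta>"
  unfolding op_cat_def op_bifun_def push_def pull_def by simp_all

lemma biproduct_op: "biproduct (op_cat D) A B P i j p q \<longleftrightarrow> biproduct D A B P p q i j"
  unfolding biproduct_def op_sel by (rule iffI; elim conjE; intro conjI; assumption)

lemma short_exangle_op:
  "short_exangle (op_cat D) (op_bifun G) K Y X v f \<delta> \<longleftrightarrow> short_exangle D G X Y K f v \<delta>"
  unfolding short_exangle_def op_sel by (rule iffI; elim conjE; intro conjI; assumption)

lemma complemented_op: "complemented D \<Longrightarrow> complemented (op_cat D)"
  unfolding complemented_def biproduct_op op_sel by blast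

lemma (in additive_category) additive_category_op: "additive_category (op_cat D)"
proof (intro additive_category.intro additive_category_axioms.intro preadditive_category.intro
    preadditive_category_axioms.intro category.intro)
  show "\<exists>Z. zero_object (op_cat D) Z" 
    using zero_object_exists unfolding zero_object_def op_sel by meson
  show "\<exists>P i j p q. biproduct (op_cat D) A B P i j p q"
    if "A \<in> Obj (op_cat D)" "B \<in> Obj (op_cat D)" for A B
    using that biproduct_exists[of A B] unfolding biproduct_op op_sel by blast
  show "A = A' \<and> B = B'"
    if "A \<in> Obj (op_cat D)" "B \<in> Obj (op_cat D)" "A' \<in> Obj (op_cat D)" "B' \<in> Obj (op_cat D)"
      "f \<in> Mor (op_cat D) A B" "f \<in> Mor (op_cat D) A' B'" for A B A' B' f
    using that Mor_disjoint[of B A B' A' f] by simp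
qed (unfold op_sel, (blast intro: Ident_in_Mor Comp_in_Mor Comp_Ident Ident_Comp
    Comp_assoc[symmetric] Hom_comm_group Comp_add_left Comp_add_right)+)

lemma (in biadditive_functor) biadditive_functor_op: "biadditive_functor (op_cat D) (op_bifun G)"
  by (intro biadditive_functor.intro biadditive_functor_axioms.intro additive_category_op;
      unfold op_sel)
    (blast intro: Ext_comm_group ExtMap_hom ExtMap_Ident ExtMap_Comp ExtMap_add_left
      ExtMap_add_right)+

lemma (in conflation_structure) conflation_structure_op:
  "conflation_structure (op_cat D) (op_bifun G) (\<lambda>X Y K f v \<delta>. conf K Y X v f \<delta>)"
proof -
  interpret op: biadditive_functor "op_cat D" "op_bifun G" by (rule biadditive_functor_op)
  show ?thesis
  proof
    show "short_exangle (op_cat D) (op_bifun G) X Y K f v \<delta>" if "conf K Y X v f \<delta>" for X Y K f v \<delta>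
      using conf_exangle[OF that] unfolding short_exangle_op .
    show "\<exists>b \<in> Mor (op_cat D) Y Y'. b \<cdot>\<^bsub>op_cat D\<^esub> f = f' \<cdot>\<^bsub>op_cat D\<^esub> a
        \<and> v' \<cdot>\<^bsub>op_cat D\<^esub> b = c \<cdot>\<^bsub>op_cat D\<^esub> v"
      if "conf K Y X v f \<delta>" "conf K' Y' X' v' f' \<delta>'" "a \<in> Mor (op_cat D) X X'"
        "c \<in> Mor (op_cat D) K K'"
        "push (op_cat D) (op_bifun G) K a \<delta> = pull (op_cat D) (op_bifun G) X' c \<delta>'"
      for X Y K f v \<delta> X' Y' K' f' v' \<delta>' a c
      using that conf_lift[OF that(2,1), of c a] by auto
    show "\<exists>Y f v. conf K Y X v f \<delta>"
      if "X \<in> Obj (op_cat D)" "K \<in> Obj (op_cat D)" "\<delta> \<in> carrier (Ext (op_bifun G) K X)" for X K \<delta>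
      using that conf_exists[of K X \<delta>] by auto
    show "conf K Y' X (v \<cdot>\<^bsub>op_cat D\<^esub> t') (t \<cdot>\<^bsub>op_cat D\<^esub> f) \<delta>"
      if "conf K Y X v f \<delta>" "Y' \<in> Obj (op_cat D)" "t \<in> Mor (op_cat D) Y Y'" "t' \<in> Mor (op_cat D) Y' Y"
        "t' \<cdot>\<^bsub>op_cat D\<^esub> t = Ident (op_cat D) Y" "t \<cdot>\<^bsub>op_cat D\<^esub> t' = Ident (op_cat D) Y'"
      for X Y K f v \<delta> Y' t t'
      using that conf_iso[OF that(1), of Y' t' t] by simp
    show "\<exists>P i j p q W d' \<delta>'. biproduct (op_cat D) Z Y P i j p q \<and>
        conf W P X d' (gadd (Hom (op_cat D) X P) (i \<cdot>\<^bsub>op_cat D\<^esub> h) (j \<cdot>\<^bsub>op_cat D\<^esub> f)) \<delta>'"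
      if "conf C Z X d h \<delta>" "Y \<in> Obj (op_cat D)" "f \<in> Mor (op_cat D) X Y" for X Z C h d \<delta> Y f
      using that conf_cone[OF that(1), of Y f] unfolding biproduct_op op_sel by blast
    show "\<exists>P i j p q W d' \<delta>'. biproduct (op_cat D) Z Y P i j p q \<and>
        conf X P W (gadd (Hom (op_cat D) P X) (h \<cdot>\<^bsub>op_cat D\<^esub> p) (f \<cdot>\<^bsub>op_cat D\<^esub> q)) d' \<delta>'"
      if "conf X Z C h d \<delta>" "Y \<in> Obj (op_cat D)" "f \<in> Mor (op_cat D) Y X" for C Z X d h \<delta> Y f
      using that conf_cocone[OF that(1), of Y f] unfolding biproduct_op op_sel by blast
  qed
qed

context conflation_structure
begin

text \<open>
  The dual of \<open>conf_comp_cancel\<close>, read off in the opposite category.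
\<close>

lemma conf_comp_cancel_op:
  assumes "complemented D" "conf C X Z d (g \<cdot> f) \<delta>"
    and "Y \<in> Obj D" "f \<in> Mor D X Y" "g \<in> Mor D Y Z"
  shows "\<exists>K v \<delta>'. conf K Y Z v g \<delta>'"
proof -
  interpret op: conflation_structure "op_cat D" "op_bifun G" "\<lambda>X Y K f v \<delta>. conf K Y X v f \<delta>"
    by (rule conflation_structure_op)
  show ?thesis
    using op.conf_comp_cancel[OF complemented_op[OF assms(1)], where f = g and g = f and X = Z and Y = Y and Z = X]
      assms by simp
qed

end

section \<open>Conflations of an extriangulated category\<close>

definition short_complex :: "'o \<Rightarrow> 'o \<Rightarrow> 'o \<Rightarrow> 'm \<Rightarrow> 'm \<Rightarrow> ('o, 'm) cpx" where
  "short_complex X Y K f v =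
     \<lparr>ob = (\<lambda>i. if i = 0 then X else if i = 1 then Y else K), diff = (\<lambda>i. if i = 0 then f else v)\<rparr>"

definition conflation :: "('o, 'm) precat \<Rightarrow> ('o, 'm, 'e) bifun \<Rightarrow> ('o, 'm, 'e) realisation \<Rightarrow>
    'o \<Rightarrow> 'o \<Rightarrow> 'o \<Rightarrow> 'm \<Rightarrow> 'm \<Rightarrow> 'e \<Rightarrow> bool" where
  "conflation D G r X Y K f v \<delta> \<longleftrightarrow> distinguished 1 D G r (short_complex X Y K f v) \<delta>"

lemma short_complex_sel [simp]:
  "ob (short_complex X Y K f v) 0 = X" "ob (short_complex X Y K f v) 1 = Y"
  "ob (short_complex X Y K f v) (Suc 0) = Y"
  "ob (short_complex X Y K f v) 2 = K" "ob (short_complex X Y K f v) (Suc (Suc 0)) = K"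
  "diff (short_complex X Y K f v) 0 = f" "diff (short_complex X Y K f v) 1 = v"
  "diff (short_complex X Y K f v) (Suc 0) = v"
  unfolding short_complex_def by simp_all

lemma is_complex_1_iff:
  "is_complex 1 D X \<longleftrightarrow> ob X 0 \<in> Obj D \<and> ob X 1 \<in> Obj D \<and> ob X 2 \<in> Obj D \<and>
     diff X 0 \<in> Mor D (ob X 0) (ob X 1) \<and> diff X 1 \<in> Mor D (ob X 1) (ob X 2) \<and>
     diff X 1 \<cdot>\<^bsub>D\<^esub> diff X 0 = gzero (Hom D (ob X 0) (ob X 2))"
  unfolding is_complex_def by (auto simp: le_Suc_eq numeral_2_eq_2)

lemma exangle_1_short_exangle:
  assumes "exangle 1 D G X \<delta>"
  shows "short_exangle D G (ob X 0) (ob X 1) (ob X 2) (diff X 0) (diff X 1) \<delta>"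
proof -
  have two: "(1::nat) + 1 = 2" by simp
  have cx: "is_complex 1 D X" and \<delta>: "\<delta> \<in> carrier (Ext G (ob X 2) (ob X 0))"
    "push D G (ob X 2) (diff X 0) \<delta> = gzero (Ext G (ob X 2) (ob X 1))"
    "pull D G (ob X 0) (diff X 1) \<delta> = gzero (Ext G (ob X 1) (ob X 0))"
    using assms unfolding exangle_def two by blast+
  have ex: "kernel (Hom D W (ob X 1)) (Hom D W (ob X 2)) (\<lambda>f. diff X 1 \<cdot>\<^bsub>D\<^esub> f)
        = (\<lambda>f. diff X 0 \<cdot>\<^bsub>D\<^esub> f) ` Mor D W (ob X 0)"
    "kernel (Hom D W (ob X 2)) (Ext G W (ob X 0)) (\<lambda>f. pull D G (ob X 0) f \<delta>)
        = (\<lambda>f. diff X 1 \<cdot>\<^bsub>D\<^esub> f) ` Mor D W (ob X 1)"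
    "kernel (Hom D (ob X 1) W) (Hom D (ob X 0) W) (\<lambda>g. g \<cdot>\<^bsub>D\<^esub> diff X 0)
        = (\<lambda>g. g \<cdot>\<^bsub>D\<^esub> diff X 1) ` Mor D (ob X 2) W"
    "kernel (Hom D (ob X 0) W) (Ext G (ob X 2) W) (\<lambda>g. push D G (ob X 2) g \<delta>)
        = (\<lambda>g. g \<cdot>\<^bsub>D\<^esub> diff X 0) ` Mor D (ob X 1) W" if "W \<in> Obj D" for W
    using assms that unfolding exangle_def by (simp_all add: numeral_2_eq_2)
  show ?thesis
    unfolding short_exangle_def
  proof (intro conjI ballI impI)
    fix A a assume A: "A \<in> Obj D"
    show "\<exists>b \<in> Mor D A (ob X 0). a = diff X 0 \<cdot>\<^bsub>D\<^esub> b"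
      if "a \<in> Mor D A (ob X 1)" "diff X 1 \<cdot>\<^bsub>D\<^esub> a = gzero (Hom D A (ob X 2))"
      using that ex(1)[OF A] unfolding kernel_def by blast
    show "\<exists>b \<in> Mor D A (ob X 1). a = diff X 1 \<cdot>\<^bsub>D\<^esub> b"
      if "a \<in> Mor D A (ob X 2)" "pull D G (ob X 0) a \<delta> = gzero (Ext G A (ob X 0))"
      using that ex(2)[OF A] unfolding kernel_def by blast
    show "\<exists>b \<in> Mor D (ob X 2) A. a = b \<cdot>\<^bsub>D\<^esub> diff X 1"
      if "a \<in> Mor D (ob X 1) A" "a \<cdot>\<^bsub>D\<^esub> diff X 0 = gzero (Hom D (ob X 0) A)"
      using that ex(3)[OF A] unfolding kernel_def by blast
    show "\<exists>b \<in> Mor D (ob X 1) A. a = b \<cdot>\<^bsub>D\<^esub> diff X 0"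
      if "a \<in> Mor D (ob X 0) A" "push D G (ob X 2) a \<delta> = gzero (Ext G (ob X 2) A)"
      using that ex(4)[OF A] unfolding kernel_def by blast
  qed (use cx[unfolded is_complex_1_iff] \<delta> in simp_all)
qed

context exact_realisation
begin

lemma distinguished_homotopy_equivalent:
  assumes "distinguished n D G r X \<delta>" "homotopy_equivalent n D (ob X 0) (ob X (n + 1)) X Y"
  shows "distinguished n D G r Y \<delta>"
  using assms homotopy_class_eqI[OF assms(2)]
  unfolding distinguished_def homotopy_equivalent_def complex_between_def by simp

lemma distinguished_exists:
  assumes "C \<in> Obj D" "A \<in> Obj D" "\<delta> \<in> carrier (Ext G C A)"
  obtains X where "distinguished n D G r X \<delta>" "ob X 0 = A" "ob X (n + 1) = C"
  using realisation_class[OF assms] assms unfolding distinguished_def complex_between_def by blast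

lemma distinguished_exangle: "distinguished n D G r X \<delta> \<Longrightarrow> exangle n D G X \<delta>"
  using R1[of "ob X (n + 1)" "ob X 0" \<delta> X]
  unfolding distinguished_def complex_between_def is_complex_def by simp

lemma distinguished_lift:
  assumes X: "distinguished n D G r X \<delta>" and Y: "distinguished n D G r Y \<rho>"
    and "ext_morphism D G (ob X (n + 1)) (ob X 0) \<delta> (ob Y (n + 1)) (ob Y 0) \<rho> a c"
  obtains f where "lift_of n D X Y a c f"
proof -
  have "ob X 0 \<in> Obj D" "ob X (n + 1) \<in> Obj D" "ob Y 0 \<in> Obj D" "ob Y (n + 1) \<in> Obj D"
    using X Y unfolding distinguished_def is_complex_def by auto
  then show ?thesis
    using R0[of "ob X (n + 1)" "ob X 0" "ob Y (n + 1)" "ob Y 0" \<delta> \<rho> X Y a c] assms that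
    unfolding distinguished_def complex_between_def by blast
qed

text \<open>
  The identity is the last differential of the complex that realises the zero extension of
  \<open>Y\<close> by a zero object.
\<close>

lemma deflation_Ident:
  assumes Y: "Y \<in> Obj D" and n: "1 \<le> n"
  shows "deflation n D G r (Ident D Y)"
proof -
  obtain Z where Z: "zero_object D Z" using zero_object_exists by blast
  then have ZO: "Z \<in> Obj D" unfolding zero_object_def by blast
  have "distinguished n D G r (triv D Z n Y) (gzero (Ext G Y Z))"
    unfolding distinguished_def
  proof (intro conjI)
    show "is_complex n D (triv D Z n Y)"
      unfolding is_complex_def triv_def Let_def using Y ZO by (auto simp: additive_simps)
    have "group (Ext G Y Z)" using Ext_group Y ZO by blast
    then show "gzero (Ext G Y Z) \<in> carrier (Ext G (ob (triv D Z n Y) (n + 1)) (ob (triv D Z n Y) 0))"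
      using n by (simp add: triv_def Let_def group.is_monoid)
    show "r (ob (triv D Z n Y) (n + 1)) (ob (triv D Z n Y) 0) (gzero (Ext G Y Z))
        = homotopy_class n D (triv D Z n Y)"
      using R2_right[OF Y Z] n by (simp add: triv_def Let_def)
  qed
  moreover have "diff (triv D Z n Y) n = Ident D Y" by (simp add: triv_def Let_def)
  ultimately show ?thesis unfolding deflation_def by blast
qed

end

locale extriangulated = n_exangulated_category 1 D G r
  for D :: "('o, 'm) precat" (structure) and G :: "('o, 'm, 'e) bifun"
    and r :: "('o, 'm, 'e) realisation"
begin

text \<open>
  A chain isomorphism that is the identity in the outer degrees does not change the homotopy class.
\<close>

lemma conflation_of_distinguished_iso:
  assumes X: "distinguished 1 D G r X \<delta>" and Y: "Y \<in> Obj D"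
    and t: "t \<in> Mor D (ob X 1) Y" and t': "t' \<in> Mor D Y (ob X 1)"
    and inv: "t' \<cdot> t = Ident D (ob X 1)" "t \<cdot> t' = Ident D Y"
  shows "conflation D G r (ob X 0) Y (ob X 2) (t \<cdot> diff X 0) (diff X 1 \<cdot> t') \<delta>"
proof -
  note [simp del] = One_nat_def
  have cX: "is_complex 1 D X" using X unfolding distinguished_def by blast
  then have ob[simp]: "ob X 0 \<in> Obj D" "ob X 1 \<in> Obj D" "ob X 2 \<in> Obj D" "Y \<in> Obj D"
    using Y unfolding is_complex_1_iff by auto
  have [simp]: "arrow t" "src t = ob X 1" "tgt t = Y" "arrow t'" "src t' = Y" "tgt t' = ob X 1"
    "arrow (diff X 0)" "src (diff X 0) = ob X 0" "tgt (diff X 0) = ob X 1"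
    "arrow (diff X 1)" "src (diff X 1) = ob X 1" "tgt (diff X 1) = ob X 2"
    using t t' cX unfolding is_complex_1_iff by (simp_all add: Mor_iff)
  have dd: "diff X 1 \<cdot> diff X 0 = gzero (Hom D (ob X 0) (ob X 2))"
    using cX unfolding is_complex_1_iff by blast
  have t't: "t' \<cdot> t \<cdot> x = x" if "arrow x" "tgt x = ob X 1" for x
    using that inv Comp_arrow_assoc[of x t t'] by (simp add: arrow_simps)
  let ?S = "short_complex (ob X 0) Y (ob X 2) (t \<cdot> diff X 0) (diff X 1 \<cdot> t')"
  have cS: "is_complex 1 D ?S"
    unfolding is_complex_1_iff by (simp add: arrow_simps t't dd)
  define f where "f i = (if i = 1 then t else Ident D (ob X i))" for i :: nat
  define g where "g i = (if i = 1 then t' else Ident D (ob X i))" for i :: nat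
  have le2: "i \<le> 1 + 1 \<longleftrightarrow> i = 0 \<or> i = 1 \<or> i = 2" for i :: nat by auto
  have le1: "i \<le> 1 \<longleftrightarrow> i = 0 \<or> i = 1" for i :: nat by auto
  have "chain_map 1 D X ?S f"
    unfolding chain_map_def le1 le2 f_def
    by (auto simp: arrow_simps t't inv)
  moreover have "chain_map 1 D ?S X g"
    unfolding chain_map_def le1 le2 g_def
    by (auto simp: arrow_simps t't inv)
  ultimately have "homotopy_equivalent 1 D (ob X 0) (ob X 2) X ?S"
    using cX cS
    by (intro isomorphic_homotopy_equivalent[where f = f and g = g])
      (auto simp: complex_between_def lift_of_def le2 le2[simplified] f_def g_def inv arrow_simps
       )
  then show ?thesis
    unfolding conflation_def using distinguished_homotopy_equivalent[OF X] by simp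
qed

text \<open>
  A distinguished complex may differ from the corresponding \<open>short_complex\<close> outside
  the relevant degrees; the identities in degrees \<open>0\<close>, \<open>1\<close>,
  \<open>2\<close> are an isomorphism between the two.
\<close>

lemma conflation_of_distinguished:
  assumes X: "distinguished 1 D G r X \<delta>"
  shows "conflation D G r (ob X 0) (ob X 1) (ob X 2) (diff X 0) (diff X 1) \<delta>"
proof -
  have cX: "is_complex 1 D X" using X unfolding distinguished_def by blast
  have 1: "ob X 1 \<in> Obj D" using cX unfolding is_complex_1_iff by blast
  then have "Ident D (ob X 1) \<cdot> diff X 0 = diff X 0" "diff X 1 \<cdot> Ident D (ob X 1) = diff X 1"
    using cX Ident_Comp Comp_Ident unfolding is_complex_1_iff by blast+
  then show ?thesis
    using conflation_of_distinguished_iso[OF X 1, of "Ident D (ob X 1)" "Ident D (ob X 1)"] 1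
    by (simp add: arrow_simps)
qed

lemma inflation_iff_conflation:
  assumes "X \<in> Obj D" "Y \<in> Obj D" "f \<in> Mor D X Y"
  shows "inflation 1 D G r f \<longleftrightarrow> (\<exists>K v \<delta>. conflation D G r X Y K f v \<delta>)"
proof
  assume "inflation 1 D G r f"
  then obtain W \<delta> where W: "distinguished 1 D G r W \<delta>" "diff W 0 = f" unfolding inflation_def by blast
  then have "is_complex 1 D W" unfolding distinguished_def by blast
  then have "ob W 0 = X" "ob W 1 = Y"
    using W(2) assms Mor_disjoint unfolding is_complex_1_iff by blast+
  then show "\<exists>K v \<delta>. conflation D G r X Y K f v \<delta>"
    using conflation_of_distinguished[OF W(1)] W(2) by auto
next
  assume "\<exists>K v \<delta>. conflation D G r X Y K f v \<delta>"
  then show "inflation 1 D G r f" unfolding conflation_def inflation_def using short_complex_sel by metis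
qed

lemma deflation_iff_conflation:
  assumes "Y \<in> Obj D" "Z \<in> Obj D" "g \<in> Mor D Y Z"
  shows "deflation 1 D G r g \<longleftrightarrow> (\<exists>K k \<delta>. conflation D G r K Y Z k g \<delta>)"
proof
  assume "deflation 1 D G r g"
  then obtain W \<delta> where W: "distinguished 1 D G r W \<delta>" "diff W 1 = g" unfolding deflation_def by blast
  then have "is_complex 1 D W" unfolding distinguished_def by blast
  then have "ob W 1 = Y" "ob W 2 = Z"
    using W(2) assms Mor_disjoint unfolding is_complex_1_iff by blast+
  then show "\<exists>K k \<delta>. conflation D G r K Y Z k g \<delta>"
    using conflation_of_distinguished[OF W(1)] W(2) by auto
next
  assume "\<exists>K k \<delta>. conflation D G r K Y Z k g \<delta>"
  then show "deflation 1 D G r g" unfolding conflation_def deflation_def using short_complex_sel by metis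
qed

lemma conflation_short_exangle:
  "conflation D G r X Y K f v \<delta> \<Longrightarrow> short_exangle D G X Y K f v \<delta>"
  unfolding conflation_def using exangle_1_short_exangle[OF distinguished_exangle] by fastforce

lemma conflation_exists:
  assumes "X \<in> Obj D" "K \<in> Obj D" "\<delta> \<in> carrier (Ext G K X)"
  shows "\<exists>Y f v. conflation D G r X Y K f v \<delta>"
proof -
  obtain W where "distinguished 1 D G r W \<delta>" "ob W 0 = X" "ob W (1 + 1) = K"
    using distinguished_exists assms by blast
  then show ?thesis using conflation_of_distinguished[of W \<delta>] by (auto simp: numeral_2_eq_2)
qed

text \<open>
  The conflation is the mapping cocone of a lift of \<open>(f, 1)\<close> to a realisation of
  \<open>f\<^sub>*\<delta>\<close>.
\<close>

lemma conflation_pushout: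
  assumes c: "conflation D G r X Z C h d \<delta>" and Y: "Y \<in> Obj D" and f: "f \<in> Mor D X Y"
  shows "\<exists>P i j p q W d' \<delta>'. biproduct D Z Y P i j p q \<and>
    conflation D G r X P W (gadd (Hom D X P) (i \<cdot> h) (j \<cdot> f)) d' \<delta>'"
proof -
  note E = short_exangle_data[OF conflation_short_exangle[OF c]]
  have "push D G C f \<delta> \<in> carrier (Ext G C Y)" using E Y f by (intro push_closed) auto
  then obtain V u v where c': "conflation D G r Y V C u v (push D G C f \<delta>)"
    using conflation_exists Y E by blast
  obtain l N where l: "lift_of 1 D (short_complex X Z C h d) (short_complex Y V C u v) f (Ident D C) l"
    and N: "mapping_cocone 1 D (short_complex X Z C h d) (short_complex Y V C u v) l N"
    and dN: "distinguished 1 D G r N (pull D G X v \<delta>)"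
    using EA2_op[of f "short_complex X Z C h d" "short_complex Y V C u v" C \<delta>] c c' f
    unfolding conflation_def by auto
  from N l obtain i j p q where "ob N 0 = X" "biproduct D Z Y (ob N 1) (i 1) (j 1) (p 1) (q 1)"
    "diff N 0 = gadd (Hom D X (ob N 1)) (i 1 \<cdot> h) (j 1 \<cdot> f)"
    unfolding mapping_cocone_def lift_of_def col_matrix_def by (auto simp del: One_nat_def)
  then show ?thesis using conflation_of_distinguished[OF dN] by metis
qed

text \<open>
  The conflation is the mapping cone of a lift of \<open>(1, f)\<close> from a realisation of
  \<open>f\<^sup>*\<delta>\<close>. The cone lists the summands \<open>Y\<close>, \<open>Z\<close>
  in the opposite order, so the biproduct is swapped to match the dual of
  \<open>conflation_pushout\<close>.
\<close>

lemma conflation_pullback: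
  assumes c: "conflation D G r C Z X d h \<delta>" and Y: "Y \<in> Obj D" and f: "f \<in> Mor D Y X"
  shows "\<exists>P i j p q W d' \<delta>'. biproduct D Z Y P i j p q \<and>
    conflation D G r W P X d' (gadd (Hom D P X) (h \<cdot> p) (f \<cdot> q)) \<delta>'"
proof -
  note E = short_exangle_data[OF conflation_short_exangle[OF c]]
  have "pull D G C f \<delta> \<in> carrier (Ext G Y C)" using E Y f by (intro pull_closed[of X]) auto
  then obtain V u v where c': "conflation D G r C V Y u v (pull D G C f \<delta>)"
    using conflation_exists Y E by blast
  obtain l M where l: "lift_of 1 D (short_complex C V Y u v) (short_complex C Z X d h) (Ident D C) f l"
    and M: "mapping_cone 1 D (short_complex C V Y u v) (short_complex C Z X d h) l M"
    and dM: "distinguished 1 D G r M (push D G X u \<delta>)"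
    using EA2[of f "short_complex C V Y u v" "short_complex C Z X d h" C \<delta>] c c' f
    unfolding conflation_def by auto
  have two: "(1::nat) + 1 = 2" by simp
  from M l obtain i j p q where ob: "ob M 2 = X"
    and P: "biproduct D Y Z (ob M 1) (i 1) (j 1) (p 1) (q 1)"
    and dM1: "diff M 1 = gadd (Hom D (ob M 1) X) (f \<cdot> p 1) (h \<cdot> q 1)"
    unfolding mapping_cone_def lift_of_def row_matrix_def two by (auto simp del: One_nat_def)
  note B = biproduct_arrow[OF P]
  have "biproduct D Z Y (ob M 1) (j 1) (i 1) (q 1) (p 1)"
    unfolding biproduct_def using B by (simp add: additive_simps)
  moreover have "gadd (Hom D (ob M 1) X) (f \<cdot> p 1) (h \<cdot> q 1) = gadd (Hom D (ob M 1) X) (h \<cdot> q 1) (f \<cdot> p 1)"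
    using B E Y f by (simp add: additive_simps)
  ultimately show ?thesis using conflation_of_distinguished[OF dM] ob dM1 by metis
qed

sublocale conflation_structure D G "conflation D G r"
proof
  show "\<exists>b \<in> Mor D Y Y'. b \<cdot> f = f' \<cdot> a \<and> v' \<cdot> b = c \<cdot> v"
    if c: "conflation D G r X Y K f v \<delta>" "conflation D G r X' Y' K' f' v' \<delta>'"
      and ac: "a \<in> Mor D X X'" "c \<in> Mor D K K'" "push D G K a \<delta> = pull D G X' c \<delta>'"
    for X Y K f v \<delta> X' Y' K' f' v' \<delta>' a c
  proof -
    obtain l where "lift_of 1 D (short_complex X Y K f v) (short_complex X' Y' K' f' v') a c l"
      using distinguished_lift[OF c[unfolded conflation_def]] ac by (auto simp: ext_morphism_def)
    then show ?thesis
      unfolding lift_of_def chain_map_def by (intro bexI[of _ "l 1"]) (auto simp: le_Suc_eq)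
  qed
  show "conflation D G r X Y' K (t \<cdot> f) (v \<cdot> t') \<delta>"
    if "conflation D G r X Y K f v \<delta>" "Y' \<in> Obj D" "t \<in> Mor D Y Y'" "t' \<in> Mor D Y' Y"
      "t' \<cdot> t = Ident D Y" "t \<cdot> t' = Ident D Y'" for X Y K f v \<delta> Y' t t'
    using conflation_of_distinguished_iso[OF that(1)[unfolded conflation_def]] that by simp
qed (fact conflation_short_exangle conflation_exists conflation_pushout conflation_pullback)+

lemma condition_WIC_iff: "condition_WIC D G r \<longleftrightarrow> weakly_idempotent_complete D"
proof
  assume wic: "condition_WIC D G r"
  show "weakly_idempotent_complete D"
    unfolding weakly_idempotent_complete_def
  proof (intro ballI allI impI)
    fix X Y p assume X: "X \<in> Obj D" and Y: "Y \<in> Obj D" and "retraction D X Y p"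
    then obtain s where p: "p \<in> Mor D X Y" and s: "s \<in> Mor D Y X" and ps: "p \<cdot> s = Ident D Y"
      unfolding retraction_def by blast
    have "deflation 1 D G r (p \<cdot> s)" unfolding ps using deflation_Ident Y by blast
    then have "deflation 1 D G r p" using wic X Y p s unfolding condition_WIC_def by blast
    then obtain K k \<delta> where "conflation D G r K X Y k p \<delta>"
      using deflation_iff_conflation X Y p by blast
    then show "\<exists>K k. kernel_of D X Y p K k"
      using short_exangle_split_kernel[OF conflation_short_exangle s ps] by blast
  qed
next
  assume wic: "weakly_idempotent_complete D"
  have comp: "complemented D"
    unfolding complemented_def using weakly_idempotent_complete_complement[OF wic] by metis
  show "condition_WIC D G r"
    unfolding condition_WIC_def
  proof (intro ballI conjI impI)
    fix X Y Z f g
    assume ob: "X \<in> Obj D" "Y \<in> Obj D" "Z \<in> Obj D" and f: "f \<in> Mor D X Y" and g: "g \<in> Mor D Y Z"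
    have gf: "g \<cdot> f \<in> Mor D X Z" using Comp_in_Mor ob f g by blast
    show "inflation 1 D G r f" if "inflation 1 D G r (g \<cdot> f)"
      using that conf_comp_cancel[OF comp _ ob(2) f g]
      unfolding inflation_iff_conflation[OF ob(1,3) gf] inflation_iff_conflation[OF ob(1,2) f] by blast
    show "deflation 1 D G r g" if "deflation 1 D G r (g \<cdot> f)"
      using that conf_comp_cancel_op[OF comp _ ob(2) f g]
      unfolding deflation_iff_conflation[OF ob(1,3) gf] deflation_iff_conflation[OF ob(2,3) g] by blast
  qed
qed

end

theorem proposition3:
  fixes C :: "('o, 'm) precat"
    and E :: "('o, 'm, 'e) bifun"
    and s :: "('o, 'm, 'e) realisation"
  assumes "extriangulated_category C E s"
  shows "condition_WIC C E s \<longleftrightarrow> weakly_idempotent_complete C"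
proof -
  interpret extriangulated C E s
    using assms unfolding extriangulated_category_def extriangulated_def .
  show ?thesis by (rule condition_WIC_iff)
qed

end
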